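(* Let $X$ be a reflexive Banach space, let $\Omega_1,\Omega_2\subset X$ be weakly sequentially closed and $\bar x\in\Omega_1\cap\Omega_2$. Then, for any $x^*\in N_{\Omega_1\cap\Omega_2}(\bar x)$ and $\varepsilon>0$, there exist points $x_1\in\Omega_1\cap B_\varepsilon(\bar x)$ and $x_2\in\Omega_2\cap B_\varepsilon(\bar x)$ such that $$\operatorname{dist}\bigl(x^*,N_{\Omega_1}(x_1)+N_{\Omega_2}(x_2)\bigr)<\varepsilon.$$
   Context: $B_\varepsilon(\bar x)$ is the open ball. For $\Omega\subset X$ and $x\in\Omega$, the Fréchet normal cone is $$N_\Omega(x):=\Bigl\{x^*\in X^*\Bigm|\limsup_{u\to x,\,u\in\Omega,\,u\ne x}\frac{\langle x^*,u-x\rangle}{\|u-x\|}\le0\Bigr\}$$ (equal to $X^*$ if $x$ is isolated in $\Omega$). *)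

theory Defs
  imports "HOL-Analysis.Analysis" "HOL-Library.Set_Algebras"
begin

definition bidual_embedding ::
    "'a::real_normed_vector \<Rightarrow> ('a \<Rightarrow>\<^sub>L real) \<Rightarrow>\<^sub>L real" where
  "bidual_embedding x = Blinfun (\<lambda>f. blinfun_apply f x)"

lemma bidual_embedding_apply [simp]:
  "blinfun_apply (bidual_embedding x) f = blinfun_apply f x"
  unfolding bidual_embedding_def
  by (simp add: bounded_linear_Blinfun_apply blinfun.bounded_linear_left)

definition reflexive_space :: "'a::real_normed_vector itself \<Rightarrow> bool" where
  "reflexive_space _ \<longleftrightarrow>
     surj (bidual_embedding :: 'a \<Rightarrow> ('a \<Rightarrow>\<^sub>L real) \<Rightarrow>\<^sub>L real)"

definition weakly_tendsto :: "(nat \<Rightarrow> 'a::real_normed_vector) \<Rightarrow> 'a \<Rightarrow> bool" where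
  "weakly_tendsto u l \<longleftrightarrow>
     (\<forall>f :: 'a \<Rightarrow>\<^sub>L real. (\<lambda>n. blinfun_apply f (u n)) \<longlonglongrightarrow> blinfun_apply f l)"

definition weakly_seq_closed :: "'a::real_normed_vector set \<Rightarrow> bool" where
  "weakly_seq_closed S \<longleftrightarrow>
     (\<forall>u l. (\<forall>n. u n \<in> S) \<and> weakly_tendsto u l \<longrightarrow> l \<in> S)"

text \<open>
  The filter \<open>at x within S\<close> excludes \<open>x\<close> itself, and it is trivial if \<open>x\<close> is isolated
  in \<open>S\<close>; then the upper limit in the extended reals is \<open>-\<infinity>\<close> and the cone is the
  whole dual space. The definition is meant for \<open>x \<in> S\<close> only.
\<close>

definition frechet_normal_cone ::
    "'a::real_normed_vector set \<Rightarrow> 'a \<Rightarrow> ('a \<Rightarrow>\<^sub>L real) set" where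
  "frechet_normal_cone S x =
     {f. Limsup (at x within S) (\<lambda>u. ereal (blinfun_apply f (u - x) / norm (u - x))) \<le> 0}"

lemma frechet_normal_cone_isolated:
  "at x within S = bot \<Longrightarrow> frechet_normal_cone S x = UNIV"
  by (simp add: frechet_normal_cone_def)

text \<open>
  Normal cones are nonempty, so the convention \<open>infdist f {} = 0\<close> never applies to
  a distance from a sum of two of them.
\<close>

lemma zero_in_frechet_normal_cone: "0 \<in> frechet_normal_cone S x"
  by (cases "at x within S = bot")
    (simp_all add: frechet_normal_cone_def Limsup_const flip: zero_ereal_def)

end

theory Submission
  imports Defs
begin

text \<open>
  Pass to the product: on \<open>X \<times> X\<close> put \<open>\<Omega> = \<Omega>1 \<times> \<Omega>2\<close> and let \<open>A (u, v) = u - v\<close>. Then \<open>\<zeta> (u, v) = xstar u\<close>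
  is a Frechet normal to \<open>\<Omega> \<inter> ker A\<close> at \<open>(xbar, xbar)\<close>, a Frechet normal to \<open>\<Omega>\<close> is a pair of normals to
  \<open>\<Omega>1\<close> and \<open>\<Omega>2\<close>, and the claim becomes a fuzzy multiplier rule: at some point near the given one there is a
  normal to \<open>\<Omega>\<close> which is close to \<open>\<zeta>\<close> on \<open>ker A\<close> (\<open>fuzzy_multiplier_rule\<close>).
  
  The multiplier rule comes from the penalty method. Let \<open>zb\<close> be the given point. Minimise
  \<open>- \<zeta> (z - zb)\<close> plus a small bump which grows away from \<open>zb\<close> plus \<open>k\<close> times a penalty for \<open>A z \<noteq> 0\<close>, over
  \<open>\<Omega>\<close> intersected with a small closed ball. By reflexivity and weak sequential closedness this minimum is
  attained, and the minimisers have a subsequence that converges weakly to a point of \<open>\<Omega> \<inter> ker A\<close>. There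
  \<open>\<zeta>\<close> is at most of the order of an arbitrarily small multiple of the radius, because it is a normal, so the
  bump forces the minimisers of that subsequence into the interior of the ball from some index on. At an
  interior minimiser \<open>\<zeta>\<close> minus the derivative of the bump minus the derivative of the penalty is a Frechet
  normal to \<open>\<Omega>\<close>; the first derivative is small and the second one vanishes on \<open>ker A\<close>.
  
  The penalty need not control the norm of \<open>A z\<close>: a finite sum of squares of functionals is enough, since
  only the weak limit has to lie in \<open>ker A\<close>. The bump, however, must be Frechet smooth and must grow with
  the norm, and a smooth equivalent norm on a nonseparable reflexive space is a deep result. It is avoided
  by a separable reduction (\<open>frechet_normal_separable_reduction\<close>): there is a separable closed subspace
  \<open>Y\<close> such that a Frechet normal to \<open>\<Omega> \<inter> Y\<close> with suitable bounds can be exchanged for a Frechet normal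
  to \<open>\<Omega>\<close> at the same point with the same bounds. All minimisation then happens in \<open>Y\<close>. Since the space is
  reflexive, the restrictions of functionals to \<open>Y\<close> have a countable dense set \<open>g 0, g 1, \<dots>\<close>, and the
  bump is the conjugate of the weighted sum of the squared distances to the \<open>g j\<close>: nearly optimal
  functionals have nearly the same distance to every \<open>g j\<close>, hence are close to each other, and by Smulian's
  criterion this is Frechet smoothness.
  
  Two tools carry the functional analysis: the Hahn--Banach theorem for a sublinear functional and a convex
  cone of lower bounds (\<open>hahn_banach_cone\<close>), and the weak-star compactness of the set of linear functionals
  below a given function, as a finite intersection property for inequalities (\<open>dominated_functional_fip\<close>).
\<close>

section \<open>The Hahn--Banach theorem for sublinear functionals\<close>

definition sublinear :: "('a::real_vector \<Rightarrow> real) \<Rightarrow> bool" where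
  "sublinear p \<longleftrightarrow> (\<forall>x y. p (x + y) \<le> p x + p y) \<and> (\<forall>t x. 0 \<le> t \<longrightarrow> p (t *\<^sub>R x) = t * p x)"

lemma sublinearI:
  assumes "\<And>x y. p (x + y) \<le> p x + p y" and "\<And>t x. 0 \<le> t \<Longrightarrow> p (t *\<^sub>R x) = t * p x"
  shows "sublinear p"
  using assms by (simp add: sublinear_def)

lemma sublinear_add: "sublinear p \<Longrightarrow> p (x + y) \<le> p x + p y"
  and sublinear_scaleR: "sublinear p \<Longrightarrow> 0 \<le> t \<Longrightarrow> p (t *\<^sub>R x) = t * p x"
  by (simp_all add: sublinear_def)

lemma sublinear_0: "sublinear p \<Longrightarrow> p 0 = 0"
  using sublinear_scaleR[of p 0 0] by simp

lemma sublinear_uminus: "sublinear p \<Longrightarrow> - p (- x) \<le> p x"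
  using sublinear_add[of p x "- x"] sublinear_0[of p] by simp

lemma sublinear_norm: "sublinear norm"
  by (rule sublinearI) (simp_all add: norm_triangle_ineq)

text \<open>
  Subtracting as much as the constraints \<open>(c, w) \<in> C\<close> permit: the infimal convolution of \<open>p\<close> with the cone \<open>C\<close>
  is again sublinear. It is finite because \<open>p (x + c) - w \<ge> p c - p (- x) - w \<ge> - p (- x)\<close>. A linear
  functional below the result satisfies \<open>w \<le> f c\<close> on the cone.
\<close>

lemma sublinear_lower:
  assumes p: "sublinear p" and C: "convex_cone C" and le: "\<And>c w. (c, w) \<in> C \<Longrightarrow> w \<le> p c"
  obtains q where "sublinear q" "\<And>x. q x \<le> p x" "\<And>c w. (c, w) \<in> C \<Longrightarrow> q (- c) \<le> - w"
proof
  define q where "q x = (INF (c, w)\<in>C. p (x + c) - w)" for x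
  have C0: "(0, 0) \<in> C"
    using convex_cone_contains_0[OF C] by (simp add: zero_prod_def)
  have bnd: "- p (- x) \<le> p (x + c) - w" if "(c, w) \<in> C" for x c w
    using sublinear_add[OF p, of "x + c" "- x"] le[OF that] by simp
  have bdd: "bdd_below ((\<lambda>(c, w). p (x + c) - w) ` C)" for x
    by (rule bdd_belowI[of _ "- p (- x)"]) (use bnd in auto)
  have q_le: "q x \<le> p (x + c) - w" if "(c, w) \<in> C" for x c w
    unfolding q_def using cINF_lower[OF bdd that, of x] by simp
  have q_ge: "m \<le> q x" if "\<And>c w. (c, w) \<in> C \<Longrightarrow> m \<le> p (x + c) - w" for m x
    unfolding q_def by (rule cINF_greatest) (use that C0 in auto)
  show "q x \<le> p x" for x
    using q_le[OF C0, of x] by simp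
  show "q (- c) \<le> - w" if "(c, w) \<in> C" for c w
    using q_le[OF that, of "- c"] sublinear_0[OF p] by simp
  have q0: "q 0 = 0"
  proof (rule antisym)
    show "q 0 \<le> 0"
      using q_le[OF C0, of 0] sublinear_0[OF p] by simp
    show "0 \<le> q 0"
      by (rule q_ge) (use le in simp)
  qed
  have scale: "t * q x \<le> q (t *\<^sub>R x)" if t: "0 < t" for t x
  proof (rule q_ge)
    fix c w
    assume cw: "(c, w) \<in> C"
    have "(1 / t) *\<^sub>R (c, w) \<in> C"
      by (rule convex_cone_scaleR[OF C _ cw]) (use t in simp)
    then have "q x \<le> p (x + (1 / t) *\<^sub>R c) - (1 / t) * w"
      using q_le by simp
    then have "t * q x \<le> t * p (x + (1 / t) *\<^sub>R c) - w"
      using t by (simp add: field_simps)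
    also have "t * p (x + (1 / t) *\<^sub>R c) = p (t *\<^sub>R x + c)"
      using t sublinear_scaleR[OF p, of t "x + (1 / t) *\<^sub>R c"] by (simp add: scaleR_add_right)
    finally show "t * q x \<le> p (t *\<^sub>R x + c) - w" .
  qed
  show "sublinear q"
  proof (rule sublinearI)
    fix x y
    have "q (x + y) - q y \<le> q x"
    proof (rule q_ge)
      fix c w
      assume cw: "(c, w) \<in> C"
      have "q (x + y) - (p (x + c) - w) \<le> q y"
      proof (rule q_ge)
        fix c' w'
        assume cw': "(c', w') \<in> C"
        have "(c + c', w + w') \<in> C"
          using convex_cone_add[OF C cw cw'] by simp
        then have "q (x + y) \<le> p ((x + y) + (c + c')) - (w + w')"
          by (rule q_le)
        also have "(x + y) + (c + c') = (x + c) + (y + c')"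
          by simp
        finally show "q (x + y) - (p (x + c) - w) \<le> p (y + c') - w'"
          using sublinear_add[OF p, of "x + c" "y + c'"] by simp
      qed
      then show "q (x + y) - q y \<le> p (x + c) - w"
        by simp
    qed
    then show "q (x + y) \<le> q x + q y"
      by simp
  next
    fix t :: real and x
    assume "0 \<le> t"
    show "q (t *\<^sub>R x) = t * q x"
    proof (cases "t = 0")
      case False
      then have t: "0 < t"
        using \<open>0 \<le> t\<close> by simp
      have "(1 / t) * q (t *\<^sub>R x) \<le> q ((1 / t) *\<^sub>R (t *\<^sub>R x))"
        by (rule scale) (use t in simp)
      then have "q (t *\<^sub>R x) \<le> t * q x"
        using t by (simp add: field_simps)
      then show ?thesis
        using scale[OF t, of x] by simp
    qed (simp add: q0)
  qed
qed

text \<open>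
  Zorn's lemma for the reversed pointwise order. The infimum of a chain is finite, since every sublinear
  \<open>q \<le> p\<close> satisfies \<open>- p (- x) \<le> q x\<close>, and it is subadditive because the chain is totally ordered: two of its
  members can be replaced by the smaller one.
\<close>

lemma sublinear_minimal:
  assumes p: "sublinear (p :: 'a::real_vector \<Rightarrow> real)"
  obtains q where "sublinear q" "\<And>x. q x \<le> p x"
    "\<And>q'. sublinear q' \<Longrightarrow> (\<And>x. q' x \<le> q x) \<Longrightarrow> q' = q"
proof -
  define A where "A = {q :: 'a \<Rightarrow> real. sublinear q \<and> (\<forall>x. q x \<le> p x)}"
  define P where "P q r \<longleftrightarrow> (\<forall>x. r x \<le> q x)" for q r :: "'a \<Rightarrow> real"
  have po: "partial_order_on A (relation_of P A)"
    by (rule partial_order_on_relation_ofI) (auto simp: P_def fun_eq_iff intro: order.trans antisym)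
  have ch: "\<exists>u\<in>A. \<forall>a\<in>K. P a u" if K: "K \<in> Chains (relation_of P A)" for K
  proof (cases "K = {}")
    case True
    then show ?thesis
      using p by (auto simp: A_def)
  next
    case False
    have KA: "a \<in> A" if "a \<in> K" for a
      using K that by (auto simp: Chains_def relation_of_def)
    have total: "P a b \<or> P b a" if "a \<in> K" "b \<in> K" for a b
      using K that by (auto simp: Chains_def relation_of_def)
    define u where "u x = (INF a\<in>K. a x)" for x
    have bnd: "- p (- x) \<le> a x" if "a \<in> K" for a x
      using KA[OF that] sublinear_uminus[of a x] by (force simp: A_def dest: spec[of _ "- x"])
    have bdd: "bdd_below ((\<lambda>a. a x) ` K)" for x
      by (rule bdd_belowI[of _ "- p (- x)"]) (use bnd in auto)
    have u_le: "u x \<le> a x" if "a \<in> K" for a x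
      unfolding u_def by (rule cINF_lower[OF bdd that])
    have u_ge: "m \<le> u x" if "\<And>a. a \<in> K \<Longrightarrow> m \<le> a x" for m x
      unfolding u_def by (rule cINF_greatest[OF False that])
    have sub: "sublinear a" if "a \<in> K" for a
      using KA[OF that] by (simp add: A_def)
    have "sublinear u"
    proof (rule sublinearI)
      fix x y
      have "u (x + y) - u y \<le> u x"
      proof (rule u_ge)
        fix a
        assume a: "a \<in> K"
        have "u (x + y) - a x \<le> u y"
        proof (rule u_ge)
          fix b
          assume b: "b \<in> K"
          show "u (x + y) - a x \<le> b y"
            using total[OF a b]
          proof
            assume "P a b"
            then have "b x \<le> a x"
              by (simp add: P_def)
            then show ?thesis
              using u_le[OF b, of "x + y"] sublinear_add[OF sub[OF b], of x y] by simp
          next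
            assume "P b a"
            then have "a y \<le> b y"
              by (simp add: P_def)
            then show ?thesis
              using u_le[OF a, of "x + y"] sublinear_add[OF sub[OF a], of x y] by simp
          qed
        qed
        then show "u (x + y) - u y \<le> a x"
          by simp
      qed
      then show "u (x + y) \<le> u x + u y"
        by simp
    next
      fix t :: real and x
      assume t: "0 \<le> t"
      have scale: "s * u y \<le> u (s *\<^sub>R y)" if "0 < s" for s y
      proof (rule u_ge)
        fix a
        assume a: "a \<in> K"
        show "s * u y \<le> a (s *\<^sub>R y)"
          using u_le[OF a, of y] that sublinear_scaleR[OF sub[OF a], of s y] by simp
      qed
      show "u (t *\<^sub>R x) = t * u x"
      proof (cases "t = 0")
        case True
        have "u 0 = (INF a\<in>K. 0)"
          unfolding u_def by (rule INF_cong) (auto simp: sublinear_0[OF sub])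
        then show ?thesis
          using True False by simp
      next
        case False
        then have t: "0 < t"
          using t by simp
        have "(1 / t) * u (t *\<^sub>R x) \<le> u ((1 / t) *\<^sub>R (t *\<^sub>R x))"
          by (rule scale) (use t in simp)
        then have "u (t *\<^sub>R x) \<le> t * u x"
          using t by (simp add: field_simps)
        then show ?thesis
          using scale[OF t, of x] by simp
      qed
    qed
    moreover have "u x \<le> p x" for x
    proof -
      obtain a where "a \<in> K"
        using False by blast
      then show ?thesis
        using u_le[of a x] KA[of a] by (force simp: A_def intro: order.trans)
    qed
    ultimately show ?thesis
      using u_le by (auto simp: A_def P_def)
  qed
  obtain q where q: "q \<in> A" and min: "\<And>a. a \<in> A \<Longrightarrow> P q a \<Longrightarrow> a = q"
    using predicate_Zorn[OF po ch] by blast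
  show thesis
  proof
    show "sublinear q" and le: "q x \<le> p x" for x
      using q by (simp_all add: A_def)
    show "q' = q" if "sublinear q'" "\<And>x. q' x \<le> q x" for q'
    proof (rule min)
      show "q' \<in> A"
        using that le by (auto simp: A_def intro: order.trans)
      show "P q q'"
        using that by (simp add: P_def)
    qed
  qed
qed

lemma convex_cone_ray: "convex_cone {(t *\<^sub>R x, t * w) |t. 0 \<le> t}" for w :: real
  unfolding convex_cone_iff
proof (intro conjI ballI allI impI)
  show "0 \<in> {(t *\<^sub>R x, t * w) |t. 0 \<le> t}"
    by (auto simp: zero_prod_def intro!: exI[of _ 0])
next
  fix a b
  assume "a \<in> {(t *\<^sub>R x, t * w) |t. 0 \<le> t}" "b \<in> {(t *\<^sub>R x, t * w) |t. 0 \<le> t}"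
  then obtain t s where "a = (t *\<^sub>R x, t * w)" "b = (s *\<^sub>R x, s * w)" "0 \<le> t" "0 \<le> s"
    by blast
  then show "a + b \<in> {(t *\<^sub>R x, t * w) |t. 0 \<le> t}"
    by (auto simp: scaleR_add_left distrib_right intro!: exI[of _ "t + s"])
next
  fix a and c :: real
  assume "a \<in> {(t *\<^sub>R x, t * w) |t. 0 \<le> t}" "0 \<le> c"
  then obtain t where "a = (t *\<^sub>R x, t * w)" "0 \<le> t"
    by blast
  then show "c *\<^sub>R a \<in> {(t *\<^sub>R x, t * w) |t. 0 \<le> t}"
    using \<open>0 \<le> c\<close> by (auto intro!: exI[of _ "c * t"])
qed

text \<open>
  A minimal sublinear functional \<open>f\<close> is linear: lowering it along the ray through \<open>x\<close> gives a sublinear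
  functional with value at most \<open>- f x\<close> at \<open>- x\<close>, which by minimality is \<open>f\<close> itself, so \<open>f\<close> is odd. The
  constraints given by \<open>C\<close> are built into the functional from which the minimal one descends.
\<close>

theorem hahn_banach_cone:
  assumes p: "sublinear p" and C: "convex_cone C" and le: "\<And>c w. (c, w) \<in> C \<Longrightarrow> w \<le> p c"
  obtains f where "linear f" "\<And>x. f x \<le> p x" "\<And>c w. (c, w) \<in> C \<Longrightarrow> w \<le> f c"
proof -
  obtain p' where p': "sublinear p'" "\<And>x. p' x \<le> p x" "\<And>c w. (c, w) \<in> C \<Longrightarrow> p' (- c) \<le> - w"
    using sublinear_lower[OF p C le] by blast
  obtain f where f: "sublinear f" "\<And>x. f x \<le> p' x"
    and min: "\<And>q. sublinear q \<Longrightarrow> (\<And>x. q x \<le> f x) \<Longrightarrow> q = f"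
    using sublinear_minimal[OF p'(1)] by blast
  have odd: "f (- x) = - f x" for x
  proof (rule antisym)
    obtain q where q: "sublinear q" "\<And>y. q y \<le> f y"
      "\<And>c w. (c, w) \<in> {(t *\<^sub>R x, t * f x) |t. 0 \<le> t} \<Longrightarrow> q (- c) \<le> - w"
    proof (rule sublinear_lower[OF f(1) convex_cone_ray])
      show "w \<le> f c" if "(c, w) \<in> {(t *\<^sub>R x, t * f x) |t. 0 \<le> t}" for c w
        using that sublinear_scaleR[OF f(1)] by auto
    qed blast
    have "q = f"
      using q(1,2) by (rule min)
    moreover have "(x, f x) \<in> {(t *\<^sub>R x, t * f x) |t. 0 \<le> t}"
      by (auto intro!: exI[of _ 1])
    ultimately show "f (- x) \<le> - f x"
      using q(3) by blast
    show "- f x \<le> f (- x)"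
      using sublinear_uminus[OF f(1), of x] by simp
  qed
  have "linear f"
  proof (rule linearI)
    show "f (x + y) = f x + f y" for x y
      using sublinear_add[OF f(1), of x y] sublinear_add[OF f(1), of "x + y" "- y"] odd[of y]
      by simp
    show "f (t *\<^sub>R x) = t *\<^sub>R f x" for t x
    proof (cases "0 \<le> t")
      case True
      then show ?thesis
        using sublinear_scaleR[OF f(1)] by simp
    next
      case False
      then have "f ((- t) *\<^sub>R x) = (- t) * f x"
        using sublinear_scaleR[OF f(1), of "- t" x] by simp
      then show ?thesis
        using odd[of "t *\<^sub>R x"] by simp
    qed
  qed
  moreover have "f x \<le> p x" for x
    using f(2)[of x] p'(2)[of x] by simp
  moreover have "w \<le> f c" if "(c, w) \<in> C" for c w
    using f(2)[of "- c"] p'(3)[OF that] odd[of c] by simp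
  ultimately show thesis
    by (rule that)
qed

lemma blinfun_of_dominated:
  fixes f :: "'a::real_normed_vector \<Rightarrow> real"
  assumes lin: "linear f" and le: "\<And>x. f x \<le> K * norm x"
  obtains F where "\<And>x. blinfun_apply F x = f x"
proof
  have "\<bar>f x\<bar> \<le> norm x * K" for x
    using le[of x] le[of "- x"] linear_neg[OF lin, of x] by (simp add: abs_le_iff mult.commute)
  then have "bounded_linear f"
    using linear_add[OF lin] linear_scale[OF lin] by (intro bounded_linear_intro[of f K]) auto
  then show "blinfun_apply (Blinfun f) x = f x" for x
    by (simp add: bounded_linear_Blinfun_apply)
qed

text \<open>
  Apply the cone version to the cone spanned by \<open>(x0 - v, \<eta>)\<close> with \<open>v \<in> V\<close>. Besides the norm, \<open>N\<close> will be a
  seminorm on a dual space.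
\<close>

lemma hahn_banach_separation:
  fixes N :: "'a::real_normed_vector \<Rightarrow> real"
  assumes V: "subspace V" and N: "sublinear N" "\<And>x. 0 \<le> N x" "\<And>x. N x \<le> K * norm x"
    and sep: "\<And>v. v \<in> V \<Longrightarrow> \<eta> \<le> N (x0 - v)"
  obtains F :: "'a \<Rightarrow>\<^sub>L real"
  where "\<And>x. F x \<le> N x" "\<And>v. v \<in> V \<Longrightarrow> F v = 0" "\<eta> \<le> F x0"
proof -
  define C where "C = {(t *\<^sub>R x0 - v, t * \<eta>) |t v. 0 \<le> t \<and> v \<in> V}"
  have CI: "(t *\<^sub>R x0 - v, t * \<eta>) \<in> C" if "0 \<le> t" "v \<in> V" for t v
    using that by (auto simp: C_def)
  have "convex_cone C"
    unfolding convex_cone_iff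
  proof (intro conjI ballI allI impI)
    show "0 \<in> C"
      using CI[of 0 0] subspace_0[OF V] by (simp add: zero_prod_def)
  next
    fix a b
    assume "a \<in> C" "b \<in> C"
    then obtain t v s u where *: "a = (t *\<^sub>R x0 - v, t * \<eta>)" "0 \<le> t" "v \<in> V"
      "b = (s *\<^sub>R x0 - u, s * \<eta>)" "0 \<le> s" "u \<in> V"
      unfolding C_def by blast
    have "((t + s) *\<^sub>R x0 - (v + u), (t + s) * \<eta>) \<in> C"
      using * by (intro CI subspace_add[OF V]) auto
    then show "a + b \<in> C"
      by (simp add: * algebra_simps)
  next
    fix a and c :: real
    assume "a \<in> C" "0 \<le> c"
    then obtain t v where *: "a = (t *\<^sub>R x0 - v, t * \<eta>)" "0 \<le> t" "v \<in> V"
      unfolding C_def by blast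
    have "((c * t) *\<^sub>R x0 - c *\<^sub>R v, (c * t) * \<eta>) \<in> C"
      using * \<open>0 \<le> c\<close> by (intro CI subspace_scale[OF V]) auto
    then show "c *\<^sub>R a \<in> C"
      by (simp add: * algebra_simps)
  qed
  moreover have "w \<le> N c" if cw: "(c, w) \<in> C" for c w
  proof -
    obtain t v where *: "c = t *\<^sub>R x0 - v" "w = t * \<eta>" "0 \<le> t" "v \<in> V"
      using cw unfolding C_def by blast
    show ?thesis
    proof (cases "t = 0")
      case True
      then show ?thesis
        using * N(2) by simp
    next
      case False
      then have t: "0 < t"
        using * by simp
      have "t * \<eta> \<le> t * N (x0 - (1 / t) *\<^sub>R v)"
        using t by (intro mult_left_mono sep subspace_scale[OF V] *)
      also have "\<dots> = N c"
        using t sublinear_scaleR[OF N(1), of t "x0 - (1 / t) *\<^sub>R v"] *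
        by (simp add: scaleR_diff_right)
      finally show ?thesis
        using * by simp
    qed
  qed
  ultimately obtain f where f: "linear f" "\<And>x. f x \<le> N x" "\<And>c w. (c, w) \<in> C \<Longrightarrow> w \<le> f c"
    using hahn_banach_cone[OF N(1)] by blast
  obtain F where F: "\<And>x. blinfun_apply F x = f x"
    using blinfun_of_dominated[OF f(1), of K] f(2) N(3) order.trans by blast
  show thesis
  proof
    show "F x \<le> N x" for x
      by (simp add: F f)
    show "F v = 0" if "v \<in> V" for v
    proof -
      have "0 \<le> f (- u)" if "u \<in> V" for u
        using f(3)[OF CI[of 0 u]] that by simp
      from this[of v] this[of "- v"] show ?thesis
        using that subspace_neg[OF V] linear_neg[OF f(1)] by (simp add: F)
    qed
    show "\<eta> \<le> F x0"
      using f(3)[OF CI[of 1 0]] subspace_0[OF V] by (simp add: F)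
  qed
qed

lemma norming_functional:
  fixes x :: "'a::real_normed_vector"
  obtains F :: "'a \<Rightarrow>\<^sub>L real" where "norm F \<le> 1" "F x = norm x"
proof -
  obtain F :: "'a \<Rightarrow>\<^sub>L real" where F: "\<And>y. F y \<le> norm y" "norm x \<le> F x"
    using hahn_banach_separation[of "{0}" norm 1 "norm x" x] sublinear_norm
    by (auto simp: subspace_def)
  have "norm F \<le> 1"
  proof (rule norm_blinfun_bound)
    show "norm (F y) \<le> 1 * norm y" for y
      using F(1)[of y] F(1)[of "- y"] by (simp add: blinfun.minus_right)
  qed simp
  then show thesis
    using F by (intro that[of F]) (auto intro: antisym)
qed

section \<open>Weak-star compactness\<close>

lemma compact_box: "compact (\<Pi>\<^sub>E i\<in>UNIV. {a i..b i :: real})"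
proof -
  have "compactin (product_topology (\<lambda>_. euclidean) UNIV) (\<Pi>\<^sub>E i\<in>UNIV. {a i..b i})"
    by (subst compactin_PiE) (simp add: compactin_euclidean_iff)
  then show ?thesis
    by (simp add: euclidean_product_topology)
qed

text \<open>
  The Banach--Alaoglu theorem in the form needed below: linearity and each inequality \<open>n y \<le> a\<close> are closed
  conditions in the product topology, and the bounds \<open>- \<sigma> (- x) \<le> n x \<le> \<sigma> x\<close> confine \<open>n\<close> to a compact box.
\<close>

theorem dominated_functional_fip:
  fixes \<sigma> :: "'a::real_vector \<Rightarrow> real" and \<C> :: "('a \<times> real) set"
  assumes fin: "\<And>\<F>. finite \<F> \<Longrightarrow> \<F> \<subseteq> \<C> \<Longrightarrow>
    \<exists>n. linear n \<and> (\<forall>x. n x \<le> \<sigma> x) \<and> (\<forall>(y, a)\<in>\<F>. n y \<le> a)"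
  obtains n where "linear n" "\<And>x. n x \<le> \<sigma> x" "\<And>y a. (y, a) \<in> \<C> \<Longrightarrow> n y \<le> a"
proof -
  define S where "S = (\<Pi>\<^sub>E x\<in>UNIV. {- \<sigma> (- x)..\<sigma> x})"
  define L where "L = (range (\<lambda>(x, y). {n :: 'a \<Rightarrow> real. n (x + y) = n x + n y})) \<union>
    (range (\<lambda>(t, x). {n :: 'a \<Rightarrow> real. n (t *\<^sub>R x) = t * n x}))"
  define H where "H = (\<lambda>(y, a). {n :: 'a \<Rightarrow> real. n y \<le> a})"
  have lin_iff: "linear n \<longleftrightarrow> n \<in> \<Inter>L" for n
    unfolding linear_iff L_def by (simp add: ball_Un split_beta)
  have inS: "n \<in> S" if "linear n" "\<And>x. n x \<le> \<sigma> x" for n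
    using that(2)[of "- _"] that(2) linear_neg[OF that(1)]
    by (auto simp: S_def minus_le_iff)
  have "compact S"
    unfolding S_def by (rule compact_box)
  moreover have "closed T" if T: "T \<in> L \<union> H ` \<C>" for T
  proof -
    have cont: "continuous_on UNIV (\<lambda>n::'a \<Rightarrow> real. n x)" for x
      by simp
    have "closed {n :: 'a \<Rightarrow> real. n (x + y) = n x + n y}" for x y
      by (intro closed_Collect_eq continuous_intros cont)
    moreover have "closed {n :: 'a \<Rightarrow> real. n (t *\<^sub>R x) = t * n x}" for t x
      by (intro closed_Collect_eq continuous_intros cont)
    moreover have "closed {n :: 'a \<Rightarrow> real. n y \<le> a}" for y a
      by (intro closed_Collect_le continuous_intros cont)
    ultimately show ?thesis
      using T by (auto simp: L_def H_def)
  qed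
  moreover have "S \<inter> \<Inter>\<G> \<noteq> {}" if \<G>: "finite \<G>" "\<G> \<subseteq> L \<union> H ` \<C>" for \<G>
  proof -
    have "finite (\<G> - L)" "\<G> - L \<subseteq> H ` \<C>"
      using \<G> by auto
    then obtain \<F> where \<F>: "\<F> \<subseteq> \<C>" "finite \<F>" "\<G> - L = H ` \<F>"
      by (meson finite_subset_image)
    obtain n where n: "linear n" "\<And>x. n x \<le> \<sigma> x" "\<forall>(y, a)\<in>\<F>. n y \<le> a"
      using fin[OF \<F>(2,1)] by blast
    have "n \<in> \<Inter>L"
      using n(1) lin_iff by blast
    moreover have "n \<in> \<Inter>(H ` \<F>)"
      using n(3) by (auto simp: H_def)
    moreover have "\<G> \<subseteq> L \<union> H ` \<F>"
      using \<F>(3) by blast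
    ultimately have "n \<in> \<Inter>\<G>"
      by blast
    then show ?thesis
      using inS[OF n(1,2)] by blast
  qed
  ultimately have "S \<inter> \<Inter>(L \<union> H ` \<C>) \<noteq> {}"
    by (rule compact_imp_fip)
  then obtain n where n: "n \<in> S" "n \<in> \<Inter>L" "n \<in> \<Inter>(H ` \<C>)"
    by blast
  show thesis
  proof
    show "linear n"
      using n lin_iff by blast
    show "n x \<le> \<sigma> x" for x
      using n(1) by (auto simp: S_def PiE_iff)
    show "n y \<le> a" if "(y, a) \<in> \<C>" for y a
      using n(3) that by (auto simp: H_def)
  qed
qed

text \<open>
  The diagonal subsequence argument, obtained from compactness of a countable product of intervals.
\<close>

lemma bounded_real_sequences_subseq:
  fixes u :: "nat \<Rightarrow> nat \<Rightarrow> real"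
  assumes "\<And>n j. \<bar>u n j\<bar> \<le> M j"
  obtains r l where "strict_mono r" "\<And>j. (\<lambda>n. u (r n) j) \<longlonglongrightarrow> l j"
proof -
  define S where "S = (\<Pi>\<^sub>E j\<in>UNIV. {- M j..M j})"
  have "compact S"
    unfolding S_def by (rule compact_box)
  then have "seq_compact S"
    by (rule compact_imp_seq_compact)
  moreover have "u n \<in> S" for n
    using assms[of n] by (auto simp: S_def abs_le_iff minus_le_iff)
  ultimately obtain l r where lr: "l \<in> S" "strict_mono r" "(u \<circ> r) \<longlonglongrightarrow> l"
    unfolding seq_compact_def by metis
  have "(\<lambda>n. u (r n) j) \<longlonglongrightarrow> l j" for j
  proof -
    have "isCont (\<lambda>v::nat \<Rightarrow> real. v j) l"
      using continuous_on_eq_continuous_at[OF open_UNIV, of "\<lambda>v::nat \<Rightarrow> real. v j"] by simp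
    then show ?thesis
      using isCont_tendsto_compose[OF _ lr(3)] by (simp add: o_def)
  qed
  then show thesis
    using lr(2) that by blast
qed

section \<open>Closures of countable sets\<close>

text \<open>
  Closed separable subspaces are built as closures of countable sets, which can only be closed under rational
  linear combinations.
\<close>

lemma subspace_closure_rational:
  fixes D :: "'a::real_normed_vector set"
  assumes ne: "D \<noteq> {}"
    and comb: "\<And>a b q r. a \<in> D \<Longrightarrow> b \<in> D \<Longrightarrow> q \<in> \<rat> \<Longrightarrow> r \<in> \<rat> \<Longrightarrow> q *\<^sub>R a + r *\<^sub>R b \<in> D"
  shows "subspace (closure D)"
proof -

  let ?f = "\<lambda>(s :: real, t :: real, a :: 'a, b). s *\<^sub>R a + t *\<^sub>R b"
  have "?f ` closure (\<rat> \<times> \<rat> \<times> D \<times> D) \<subseteq> closure D"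
  proof (rule image_closure_subset)
    show "continuous_on (closure (\<rat> \<times> \<rat> \<times> D \<times> D)) ?f"
      by (simp add: split_beta) (intro continuous_intros)
    show "?f ` (\<rat> \<times> \<rat> \<times> D \<times> D) \<subseteq> closure D"
      using comb closure_subset by fastforce
  qed simp
  then have *: "s *\<^sub>R a + t *\<^sub>R b \<in> closure D" if "a \<in> closure D" "b \<in> closure D" for s t a b
    using that by (auto simp: Rats_closure_real closure_Times image_subset_iff)
  obtain d where d: "d \<in> closure D"
    using ne closure_subset by blast
  show ?thesis
    unfolding subspace_def using *[OF d d, of 0 0] *[of _ _ 1 1] *[OF _ d, of _ _ 0] by auto
qed

lemma countable_set_closed_under:
  fixes h :: "'a \<Rightarrow> 'a \<Rightarrow> 'a set"
  assumes D0: "countable D0" and h: "\<And>a b. countable (h a b)"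
  shows "\<exists>D. D0 \<subseteq> D \<and> countable D \<and> (\<forall>a\<in>D. \<forall>b\<in>D. h a b \<subseteq> D)"
proof -
  define E where "E = rec_nat D0 (\<lambda>_ S. S \<union> (\<Union>a\<in>S. \<Union>b\<in>S. h a b))"
  have E: "E 0 = D0" "E (Suc n) = E n \<union> (\<Union>a\<in>E n. \<Union>b\<in>E n. h a b)" for n
    by (simp_all add: E_def)
  have "countable (E n)" for n
    by (induction n) (use D0 h in \<open>auto simp: E\<close>)
  moreover have "mono E"
    by (rule incseq_SucI) (auto simp: E)
  ultimately show ?thesis
  proof (intro exI[of _ "\<Union>n. E n"] conjI ballI)
    show "D0 \<subseteq> (\<Union>n. E n)"
      using E(1) by blast
    fix a b
    assume "a \<in> (\<Union>n. E n)" "b \<in> (\<Union>n. E n)"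
    then obtain i j where "a \<in> E i" "b \<in> E j"
      by blast
    then have "a \<in> E (max i j)" "b \<in> E (max i j)"
      using monoD[OF \<open>mono E\<close>, of i "max i j"] monoD[OF \<open>mono E\<close>, of j "max i j"] by auto
    then have "h a b \<subseteq> E (Suc (max i j))"
      unfolding E(2) by blast
    then show "h a b \<subseteq> (\<Union>n. E n)"
      by blast
  qed auto
qed

section \<open>Separable reduction for Frechet normals\<close>

text \<open>
  The description by \<open>\<eta>\<close> and \<open>\<delta>\<close> includes \<open>u = x\<close> and treats isolated points like all others.
\<close>

lemma frechet_normal_iff:
  "f \<in> frechet_normal_cone S x \<longleftrightarrow>
    (\<forall>\<eta>>0. \<exists>\<delta>>0. \<forall>u\<in>S. norm (u - x) < \<delta> \<longrightarrow> f (u - x) \<le> \<eta> * norm (u - x))"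
    (is "?L \<longleftrightarrow> ?R")
proof
  assume L: ?L
  show ?R
  proof (intro allI impI)
    fix \<eta> :: real
    assume "0 < \<eta>"
    then have "eventually (\<lambda>u. ereal (f (u - x) / norm (u - x)) < ereal \<eta>) (at x within S)"
      using L unfolding frechet_normal_cone_def Limsup_le_iff
      by (auto simp flip: zero_ereal_def dest!: spec[of _ "ereal \<eta>"])
    then obtain \<delta> where \<delta>: "0 < \<delta>"
      "\<And>u. u \<in> S \<Longrightarrow> u \<noteq> x \<Longrightarrow> dist u x < \<delta> \<Longrightarrow> f (u - x) / norm (u - x) < \<eta>"
      unfolding eventually_at by auto
    have "f (u - x) \<le> \<eta> * norm (u - x)" if "u \<in> S" "norm (u - x) < \<delta>" for u
    proof (cases "u = x")
      case False
      then show ?thesis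
        using \<delta>(2)[of u] that by (simp add: dist_norm divide_less_eq)
    qed (simp add: blinfun.zero_right)
    then show "\<exists>\<delta>>0. \<forall>u\<in>S. norm (u - x) < \<delta> \<longrightarrow> f (u - x) \<le> \<eta> * norm (u - x)"
      using \<delta>(1) by blast
  qed
next
  assume R: ?R
  have "eventually (\<lambda>u. ereal (f (u - x) / norm (u - x)) < y) (at x within S)" if y: "0 < y" for y
  proof -
    obtain \<eta> where \<eta>: "0 < ereal \<eta>" "ereal \<eta> < y"
      using ereal_dense2[OF y] by auto
    then obtain \<delta> where \<delta>: "0 < \<delta>"
      "\<And>u. u \<in> S \<Longrightarrow> norm (u - x) < \<delta> \<Longrightarrow> f (u - x) \<le> \<eta> * norm (u - x)"
      using R by auto
    have "f (u - x) / norm (u - x) \<le> \<eta>" if "u \<in> S" "u \<noteq> x" "dist u x < \<delta>" for u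
      using \<delta>(2)[of u] that by (simp add: dist_norm divide_le_eq)
    then have "ereal (f (u - x) / norm (u - x)) < y" if "u \<in> S" "u \<noteq> x" "dist u x < \<delta>" for u
      using that \<eta>(2) by (meson ereal_less_eq(3) le_less_trans)
    then show ?thesis
      unfolding eventually_at using \<delta>(1) by blast
  qed
  then show ?L
    unfolding frechet_normal_cone_def Limsup_le_iff by simp
qed

text \<open>
  A list \<open>s\<close> prescribes finitely many radii of a modulus for a Frechet normal: within distance
  \<open>1 / Suc (s ! m)\<close> of \<open>x\<close> the normal inequality holds with slope \<open>1 / Suc m\<close>. Finite lists of natural numbers
  keep the number of prescriptions countable; infinitely many radii are recovered by compactness.
\<close>

definition feasible :: "('a::real_normed_vector \<Rightarrow> real) \<Rightarrow> 'a set \<Rightarrow> nat list \<Rightarrow> 'a \<Rightarrow> bool" where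
  "feasible \<sigma> S s x \<longleftrightarrow> (\<exists>n. linear n \<and> (\<forall>z. n z \<le> \<sigma> z) \<and>
     (\<forall>u\<in>S. \<forall>m<length s. norm (u - x) < 1 / real (Suc (s ! m)) \<longrightarrow> n (u - x) \<le> norm (u - x) / real (Suc m)))"

text \<open>
  Infeasibility has a finite reason which is stable under moving the base point: if no functional meets the
  prescription \<open>s\<close> for \<open>S\<close> at \<open>x\<close>, then a finite subset of \<open>S\<close> already excludes all functionals at all points
  near \<open>x\<close>. The stability rests on the strict inequality for the radii and on the bound \<open>K\<close>.
\<close>

lemma feasible_compactness:
  fixes \<sigma> :: "'a::real_normed_vector \<Rightarrow> real"
  assumes K: "0 \<le> K" "\<And>z. \<sigma> z \<le> K * norm z"
    and fin: "\<And>F r. finite F \<Longrightarrow> F \<subseteq> S \<Longrightarrow> 0 < r \<Longrightarrow> \<exists>x'. norm (x' - x) < r \<and> feasible \<sigma> F s x'"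
  shows "feasible \<sigma> S s x"
proof -
  define \<C> where "\<C> = {(u - x, norm (u - x) / real (Suc m) + \<eta>) |u m \<eta>.
    u \<in> S \<and> m < length s \<and> norm (u - x) < 1 / real (Suc (s ! m)) \<and> 0 < \<eta>}"
  define adm where "adm n x' u \<longleftrightarrow> linear n \<and> (\<forall>z. n z \<le> \<sigma> z) \<and>
     (\<forall>m<length s. norm (u - x') < 1 / real (Suc (s ! m)) \<longrightarrow> n (u - x') \<le> norm (u - x') / real (Suc m))"
    for n x' u
  \<comment> \<open>The slack \<open>\<eta>\<close> in each inequality of \<open>\<C>\<close> pays for replacing the base point \<open>x\<close> by a near \<open>x'\<close>.\<close>
  have stable: "\<exists>u r. u \<in> S \<and> 0 < r \<and> (\<forall>x' n. norm (x' - x) < r \<longrightarrow> adm n x' u \<longrightarrow> n (fst e) \<le> snd e)"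
    if e: "e \<in> \<C>" for e
  proof -
    obtain u m \<eta> where *: "e = (u - x, norm (u - x) / real (Suc m) + \<eta>)" "u \<in> S" "m < length s"
      "norm (u - x) < 1 / real (Suc (s ! m))" "0 < \<eta>"
      using e unfolding \<C>_def by blast
    \<comment> \<open>The first bound keeps \<open>u\<close> within the radius seen from \<open>x'\<close>; moving the base point costs
      at most \<open>norm (x' - x)\<close> on the right and \<open>K * norm (x' - x)\<close> on the left.\<close>
    define r where "r = min (1 / real (Suc (s ! m)) - norm (u - x)) (\<eta> / (K + 1))"
    have r: "0 < r"
      using * K by (simp add: r_def)
    have "n (u - x) \<le> norm (u - x) / real (Suc m) + \<eta>" if x': "norm (x' - x) < r" and n: "adm n x' u" for x' n
    proof -
      have tri: "norm (u - x') \<le> norm (u - x) + norm (x' - x)"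
        using norm_triangle_ineq4[of "u - x" "x' - x"] by simp
      have "norm (u - x') < 1 / real (Suc (s ! m))"
        using tri x' by (simp add: r_def)
      then have "n (u - x') \<le> norm (u - x') / real (Suc m)"
        using n *(3) by (simp add: adm_def)
      also have "\<dots> \<le> norm (u - x) / real (Suc m) + norm (x' - x)"
      proof -
        have "norm (u - x') / real (Suc m) \<le> (norm (u - x) + norm (x' - x)) / real (Suc m)"
          using tri by (intro divide_right_mono) auto
        also have "\<dots> = norm (u - x) / real (Suc m) + norm (x' - x) / real (Suc m)"
          by (rule add_divide_distrib)
        also have "norm (x' - x) / real (Suc m) \<le> norm (x' - x) / 1"
          by (intro divide_left_mono) auto
        finally show ?thesis
          by simp
      qed
      finally have 1: "n (u - x') \<le> norm (u - x) / real (Suc m) + norm (x' - x)" .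
      have 2: "n (x' - x) \<le> K * norm (x' - x)"
        using n K(2)[of "x' - x"] unfolding adm_def by (blast intro: order.trans)
      have 3: "n (u - x) = n (u - x') + n (x' - x)"
        using n linear_add[of n "u - x'" "x' - x"] by (simp add: adm_def)
      have "norm (x' - x) \<le> \<eta> / (K + 1)"
        using x' by (simp add: r_def)
      then have "norm (x' - x) * (K + 1) \<le> \<eta>"
        using K(1) by (simp add: pos_le_divide_eq)
      then have "K * norm (x' - x) + norm (x' - x) \<le> \<eta>"
        by (simp add: algebra_simps)
      then show ?thesis
        using 1 2 3 by simp
    qed
    then show ?thesis
      using r *(1,2) by auto
  qed
  then obtain U R where UR: "\<And>e. e \<in> \<C> \<Longrightarrow> U e \<in> S" "\<And>e. e \<in> \<C> \<Longrightarrow> 0 < R e"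
    "\<And>e x' n. e \<in> \<C> \<Longrightarrow> norm (x' - x) < R e \<Longrightarrow> adm n x' (U e) \<Longrightarrow> n (fst e) \<le> snd e"
    by metis
  obtain n where n: "linear n" "\<And>z. n z \<le> \<sigma> z" "\<And>y a. (y, a) \<in> \<C> \<Longrightarrow> n y \<le> a"
  proof (rule dominated_functional_fip[of \<C> \<sigma>])
    fix \<F>
    assume \<F>: "finite \<F>" "\<F> \<subseteq> \<C>"
    define r where "r = Min (insert 1 (R ` \<F>))"
    have "0 < r"
      using \<F> UR(2) by (auto simp: r_def)
    moreover have "finite (U ` \<F>)" "U ` \<F> \<subseteq> S"
      using \<F> UR(1) by auto
    ultimately obtain x' where x': "norm (x' - x) < r" "feasible \<sigma> (U ` \<F>) s x'"
      using fin by blast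
    then obtain n where n: "linear n" "\<forall>z. n z \<le> \<sigma> z" "\<forall>e\<in>\<F>. adm n x' (U e)"
      unfolding feasible_def adm_def by auto
    have "n (fst e) \<le> snd e" if "e \<in> \<F>" for e
    proof (rule UR(3))
      have "r \<le> R e"
        using \<F>(1) that by (simp add: r_def)
      then show "norm (x' - x) < R e"
        using x'(1) by simp
    qed (use that \<F> n in auto)
    then show "\<exists>n. linear n \<and> (\<forall>x. n x \<le> \<sigma> x) \<and> (\<forall>(y, a)\<in>\<F>. n y \<le> a)"
      using n by (intro exI[of _ n]) auto
  qed blast
  have "n (u - x) \<le> norm (u - x) / real (Suc m)"
    if "u \<in> S" "m < length s" "norm (u - x) < 1 / real (Suc (s ! m))" for u m
  proof (rule field_le_epsilon)
    fix \<eta> :: real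
    assume "0 < \<eta>"
    then have "(u - x, norm (u - x) / real (Suc m) + \<eta>) \<in> \<C>"
      using that unfolding \<C>_def by blast
    then show "n (u - x) \<le> norm (u - x) / real (Suc m) + \<eta>"
      by (rule n(3))
  qed
  then show ?thesis
    unfolding feasible_def using n(1,2) by blast
qed

text \<open>
  Close a countable set \<open>D\<close> under rational combinations and under the choice of finite obstructions: whenever
  some finite subset of \<open>\<Omega>\<close> excludes a prescription at all points of a ball with centre in \<open>D\<close> and radius
  \<open>1 / Suc j\<close>, one such subset is put into \<open>D\<close>. If a prescription cannot be met for \<open>\<Omega>\<close> at a point \<open>x\<close> of the
  closure of \<open>D\<close>, then by \<open>feasible_compactness\<close> there is an obstruction for a ball that contains \<open>x\<close> and has
  centre in \<open>D\<close>, so there is one inside \<open>\<Omega> \<inter> closure D\<close>. Contrapositively, what a normal to \<open>\<Omega> \<inter> closure D\<close>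
  achieves can be achieved for \<open>\<Omega>\<close>.
  
  The obstructions are chosen for balls, not for points, because there are only countably many choices
  but uncountably many points in the closure.
\<close>

theorem frechet_normal_separable_reduction:
  fixes \<Omega> :: "'a::real_normed_vector set" and \<sigma> :: "nat \<Rightarrow> 'a \<Rightarrow> real"
  assumes K: "\<And>c. 0 \<le> K c" "\<And>c z. \<sigma> c z \<le> K c * norm z" and D0: "countable D0"
  obtains D where "countable D" "D0 \<subseteq> D" "subspace (closure D)"
    "\<And>c x n. \<lbrakk>x \<in> closure D; n \<in> frechet_normal_cone (\<Omega> \<inter> closure D) x; \<And>z. n z \<le> \<sigma> c z\<rbrakk>
      \<Longrightarrow> \<exists>n'\<in>frechet_normal_cone \<Omega> x. \<forall>z. n' z \<le> \<sigma> c z"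
proof -
  define bad where "bad c d s j F \<longleftrightarrow> finite F \<and> F \<subseteq> \<Omega> \<and>
    (\<forall>x. norm (x - d) < 1 / real (Suc j) \<longrightarrow> \<not> feasible (\<sigma> c) F s x)" for c d s j F
  define W where "W c d s j = (if \<exists>F. bad c d s j F then SOME F. bad c d s j F else {})" for c d s j
  have W: "bad c d s j (W c d s j)" if "bad c d s j F" for c d s j F
    unfolding W_def using that by (auto intro: someI)
  have W_countable: "countable (W c d s j)" for c d s j
  proof (cases "\<exists>F. bad c d s j F")
    case True
    then have "bad c d s j (W c d s j)"
      using W by blast
    then show ?thesis
      by (simp add: bad_def countable_finite)
  qed (simp add: W_def)
  define h where "h a b = (\<lambda>(q, r). q *\<^sub>R a + r *\<^sub>R b) ` (\<rat> \<times> \<rat>) \<union> (\<Union>c s j. W c a s j)" for a b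
  have h_countable: "countable (h a b)" for a b
    unfolding h_def
    by (intro countable_Un countable_image countable_SIGMA countable_UN countable_rat W_countable) simp_all
  have "\<exists>D. insert 0 D0 \<subseteq> D \<and> countable D \<and> (\<forall>a\<in>D. \<forall>b\<in>D. h a b \<subseteq> D)"
    by (rule countable_set_closed_under) (simp_all add: D0 h_countable)
  then obtain D where D: "insert 0 D0 \<subseteq> D" "countable D" and D_closed: "\<forall>a\<in>D. \<forall>b\<in>D. h a b \<subseteq> D"
    by (elim exE conjE)
  have W_D: "W c d s j \<subseteq> D" if "d \<in> D" for c d s j
  proof -
    have "W c d s j \<subseteq> h d d"
      unfolding h_def by (rule subsetI, rule UnI2) (rule UN_I[OF UNIV_I], rule UN_I[OF UNIV_I], rule UN_I[OF UNIV_I])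
    then show ?thesis
      using bspec[OF bspec[OF D_closed that] that] by (rule subset_trans)
  qed
  \<comment> \<open>The functional that solves the problem on \<open>\<Omega>\<close> may differ from the one on \<open>\<Omega> \<inter> closure D\<close>.\<close>
  have lift: "feasible (\<sigma> c) \<Omega> s x" if x: "x \<in> closure D" and feas: "feasible (\<sigma> c) (\<Omega> \<inter> closure D) s x"
    for c s x
  proof (rule feasible_compactness[OF K(1)[of c] K(2)])
    fix F and r :: real
    assume F: "finite F" "F \<subseteq> \<Omega>" and r: "0 < r"
    show "\<exists>x'. norm (x' - x) < r \<and> feasible (\<sigma> c) F s x'"
    proof (rule ccontr)
      assume none: "\<not> ?thesis"
      \<comment> \<open>Half the radius, so that the ball around \<open>d\<close> contains \<open>x\<close> and lies in the ball around \<open>x\<close>.\<close>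
      obtain j where j: "1 / real (Suc j) < r / 2"
        using r nat_approx_posE[of "r / 2"] by auto
      obtain d where d: "d \<in> D" "dist d x < 1 / real (Suc j)"
        using x unfolding closure_approachable by (metis divide_pos_pos of_nat_0_less_iff zero_less_Suc zero_less_one)
      have "bad c d s j F"
        unfolding bad_def
      proof (intro conjI F allI impI)
        fix x'
        assume "norm (x' - d) < 1 / real (Suc j)"
        then have "norm (x' - x) < r"
          using d(2) j norm_triangle_ineq[of "x' - d" "d - x"] by (simp add: dist_norm)
        then show "\<not> feasible (\<sigma> c) F s x'"
          using none by blast
      qed
      then have "bad c d s j (W c d s j)"
        by (rule W)
      then have "W c d s j \<subseteq> \<Omega>" "\<not> feasible (\<sigma> c) (W c d s j) s x"
        using d(2) by (auto simp: bad_def dist_norm norm_minus_commute)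
      moreover have "W c d s j \<subseteq> closure D"
        using W_D[OF d(1)] closure_subset by blast
      ultimately show False
        using feas unfolding feasible_def by (meson IntI subsetD)
    qed
  qed
  show thesis
  proof
    show "countable D" "D0 \<subseteq> D"
      using D by auto
    show "subspace (closure D)"
    proof (rule subspace_closure_rational)
      show "q *\<^sub>R a + r *\<^sub>R b \<in> D" if "a \<in> D" "b \<in> D" "q \<in> \<rat>" "r \<in> \<rat>" for a b q r
      proof -
        have "q *\<^sub>R a + r *\<^sub>R b \<in> h a b"
          unfolding h_def by (rule UnI1) (rule image_eqI[of _ _ "(q, r)"], use that in simp_all)
        then show ?thesis
          using bspec[OF bspec[OF D_closed that(1)] that(2)] by (rule subsetD[rotated])
      qed
    qed (use D in auto)
    fix c x and n :: "'a \<Rightarrow>\<^sub>L real"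
    assume x: "x \<in> closure D" and n: "n \<in> frechet_normal_cone (\<Omega> \<inter> closure D) x"
      and le: "\<And>z. n z \<le> \<sigma> c z"
    have "\<exists>d::nat. \<forall>u\<in>\<Omega> \<inter> closure D. norm (u - x) < 1 / real (Suc d) \<longrightarrow> n (u - x) \<le> norm (u - x) / real (Suc m)" for m
    proof -
      obtain \<delta> where "0 < \<delta>"
        and \<delta>: "\<forall>u\<in>\<Omega> \<inter> closure D. norm (u - x) < \<delta> \<longrightarrow> n (u - x) \<le> 1 / real (Suc m) * norm (u - x)"
        using n unfolding frechet_normal_iff by (metis divide_pos_pos of_nat_0_less_iff zero_less_Suc zero_less_one)
      then obtain d where "1 / real (Suc d) < \<delta>"
        using nat_approx_posE by blast
      then show ?thesis
        using \<delta> by (intro exI[of _ d]) auto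
    qed
    then obtain d :: "nat \<Rightarrow> nat" where d: "\<And>m u. u \<in> \<Omega> \<inter> closure D \<Longrightarrow> norm (u - x) < 1 / real (Suc (d m)) \<Longrightarrow>
        n (u - x) \<le> norm (u - x) / real (Suc m)"
      by metis
    \<comment> \<open>All finite initial parts of the modulus \<open>d\<close> are feasible for \<open>\<Omega>\<close>; compactness then
      yields one functional that obeys the whole modulus.\<close>
    have feas: "feasible (\<sigma> c) \<Omega> (map d [0..<N]) x" for N
    proof (rule lift[OF x])
      show "feasible (\<sigma> c) (\<Omega> \<inter> closure D) (map d [0..<N]) x"
        unfolding feasible_def using d le
        by (intro exI[of _ "blinfun_apply n"])
          (auto intro: bounded_linear.linear blinfun.bounded_linear_right)
    qed
    define \<C> where "\<C> = {(u - x, norm (u - x) / real (Suc m)) |u m. u \<in> \<Omega> \<and> norm (u - x) < 1 / real (Suc (d m))}"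
    obtain n' where n': "linear n'" "\<And>z. n' z \<le> \<sigma> c z" "\<And>y a. (y, a) \<in> \<C> \<Longrightarrow> n' y \<le> a"
    proof (rule dominated_functional_fip[of \<C> "\<sigma> c"])
      fix \<F>
      assume \<F>: "finite \<F>" "\<F> \<subseteq> \<C>"
      then have "\<forall>e\<in>\<F>. \<exists>m u. e = (u - x, norm (u - x) / real (Suc m)) \<and> u \<in> \<Omega> \<and> norm (u - x) < 1 / real (Suc (d m))"
        unfolding \<C>_def by blast
      then obtain M U where MU: "\<And>e. e \<in> \<F> \<Longrightarrow> e = (U e - x, norm (U e - x) / real (Suc (M e))) \<and>
          U e \<in> \<Omega> \<and> norm (U e - x) < 1 / real (Suc (d (M e)))"
        by metis
      define N where "N = Suc (Max (insert 0 (M ` \<F>)))"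
      have N: "M e < N" if "e \<in> \<F>" for e
        using that \<F>(1) by (auto simp: N_def less_Suc_eq_le intro!: Max_ge)
      obtain n' where n': "linear n'" "\<forall>z. n' z \<le> \<sigma> c z"
        "\<And>u m. u \<in> \<Omega> \<Longrightarrow> m < N \<Longrightarrow> norm (u - x) < 1 / real (Suc (d m)) \<Longrightarrow> n' (u - x) \<le> norm (u - x) / real (Suc m)"
        using feas[of N] unfolding feasible_def by auto
      have "n' (fst e) \<le> snd e" if "e \<in> \<F>" for e
        using n'(3)[of "U e" "M e"] MU[OF that] N[OF that] by (metis fst_conv snd_conv)
      then show "\<exists>n. linear n \<and> (\<forall>x. n x \<le> \<sigma> c x) \<and> (\<forall>(y, a)\<in>\<F>. n y \<le> a)"
        using n' by (intro exI[of _ n']) auto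
    qed blast
    obtain N' where N': "\<And>z. blinfun_apply N' z = n' z"
      using blinfun_of_dominated[OF n'(1), of "K c"] n'(2) K(2) order.trans by blast
    have "N' \<in> frechet_normal_cone \<Omega> x"
      unfolding frechet_normal_iff
    proof (intro allI impI)
      fix \<eta> :: real
      assume "0 < \<eta>"
      then obtain m where m: "1 / real (Suc m) < \<eta>"
        using nat_approx_posE by blast
      have "N' (u - x) \<le> \<eta> * norm (u - x)" if "u \<in> \<Omega>" "norm (u - x) < 1 / real (Suc (d m))" for u
      proof -
        have "N' (u - x) \<le> norm (u - x) / real (Suc m)"
          unfolding N' by (rule n'(3)) (use that in \<open>auto simp: \<C>_def\<close>)
        also have "\<dots> = (1 / real (Suc m)) * norm (u - x)"
          by simp
        also have "\<dots> \<le> \<eta> * norm (u - x)"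
          using m by (intro mult_right_mono) auto
        finally show ?thesis .
      qed
      then show "\<exists>\<delta>>0. \<forall>u\<in>\<Omega>. norm (u - x) < \<delta> \<longrightarrow> N' (u - x) \<le> \<eta> * norm (u - x)"
        by (intro exI[of _ "1 / real (Suc (d m))"]) auto
    qed
    then show "\<exists>n'\<in>frechet_normal_cone \<Omega> x. \<forall>z. n' z \<le> \<sigma> c z"
      using N' n'(2) by (intro bexI[of _ N']) auto
  qed
qed

section \<open>Weakly closed sets and reflexivity\<close>

text \<open>
  A functional that vanishes on \<open>Y\<close> and is at least \<open>infdist x Y\<close> at \<open>x\<close> separates a point outside \<open>Y\<close>.
\<close>

lemma in_closed_subspace_if_annihilated:
  fixes Y :: "'a::real_normed_vector set"
  assumes Y: "subspace Y" "closed Y"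
    and ann: "\<And>F :: 'a \<Rightarrow>\<^sub>L real. (\<And>v. v \<in> Y \<Longrightarrow> F v = 0) \<Longrightarrow> F x = 0"
  shows "x \<in> Y"
proof (rule ccontr)
  assume "x \<notin> Y"
  have ne: "Y \<noteq> {}"
    using subspace_0[OF Y(1)] by blast
  obtain F :: "'a \<Rightarrow>\<^sub>L real" where F: "\<And>v. v \<in> Y \<Longrightarrow> F v = 0" "infdist x Y \<le> F x"
  proof (rule hahn_banach_separation[OF Y(1) sublinear_norm])
    show "infdist x Y \<le> norm (x - v)" if "v \<in> Y" for v
      using infdist_le[OF that, of x] by (simp add: dist_norm)
    show "norm v \<le> 1 * norm v" for v :: 'a
      by simp
  qed auto
  have "0 < infdist x Y"
    using \<open>x \<notin> Y\<close> Y(2) ne in_closed_iff_infdist_zero[OF Y(2) ne, of x] infdist_nonneg[of x Y] by simp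
  then show False
    using F(2) ann[OF F(1)] by simp
qed

lemma weakly_tendsto_closed_subspace:
  assumes "subspace Y" "closed Y" "\<And>n. u n \<in> Y" "weakly_tendsto u l"
  shows "l \<in> Y"
proof (rule in_closed_subspace_if_annihilated[OF assms(1,2)])
  fix F :: "'a \<Rightarrow>\<^sub>L real"
  assume "\<And>v. v \<in> Y \<Longrightarrow> F v = 0"
  then have "(\<lambda>n. F (u n)) = (\<lambda>_. 0)"
    using assms(3) by auto
  moreover have "(\<lambda>n. F (u n)) \<longlonglongrightarrow> F l"
    using assms(4) by (simp add: weakly_tendsto_def)
  ultimately show "F l = 0"
    by (simp add: LIMSEQ_const_iff)
qed

lemma weakly_tendsto_cball:
  fixes u :: "nat \<Rightarrow> 'a::real_normed_vector"
  assumes "\<And>n. u n \<in> cball a r" "weakly_tendsto u l"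
  shows "l \<in> cball a r"
proof -
  obtain F :: "'a \<Rightarrow>\<^sub>L real" where F: "norm F \<le> 1" "F (l - a) = norm (l - a)"
    by (rule norming_functional)
  have "F l \<le> F a + r"
  proof (rule LIMSEQ_le_const2)
    show "(\<lambda>n. F (u n)) \<longlonglongrightarrow> F l"
      using assms(2) by (simp add: weakly_tendsto_def)
    have "F (u n) \<le> F a + r" for n
    proof -
      have "F (u n - a) \<le> norm F * norm (u n - a)"
        using norm_blinfun[of F "u n - a"] by simp
      also have "\<dots> \<le> 1 * r"
        using F(1) assms(1)[of n] by (intro mult_mono) (auto simp: dist_norm norm_minus_commute)
      finally show ?thesis
        by (simp add: blinfun.diff_right)
    qed
    then show "\<exists>N. \<forall>n\<ge>N. F (u n) \<le> F a + r"
      by blast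
  qed
  then show ?thesis
    using F(2) by (simp add: blinfun.diff_right dist_norm norm_minus_commute)
qed

lemma reflexive_representation:
  fixes \<Lambda> :: "('a::real_normed_vector \<Rightarrow>\<^sub>L real) \<Rightarrow> real"
  assumes refl: "reflexive_space TYPE('a)" and lin: "linear \<Lambda>" and le: "\<And>f. \<Lambda> f \<le> K * norm f"
  obtains x where "\<And>f. \<Lambda> f = blinfun_apply f x"
proof -
  obtain L where L: "\<And>f. blinfun_apply L f = \<Lambda> f"
    using blinfun_of_dominated[OF lin le] by blast
  obtain x where "L = bidual_embedding x"
    using refl unfolding reflexive_space_def by (metis surjD)
  then show thesis
    using that L by (metis bidual_embedding_apply)
qed

section \<open>Separable subspaces of reflexive spaces\<close>

text \<open>
  This is the norm of the restriction of \<open>f\<close> to \<open>Y\<close>. Functionals on \<open>Y\<close> are represented by functionals on the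
  whole space, with this seminorm in place of the norm of the dual of \<open>Y\<close>.
\<close>

definition norm_on :: "'a::real_normed_vector set \<Rightarrow> ('a \<Rightarrow>\<^sub>L real) \<Rightarrow> real" where
  "norm_on Y f = (SUP y\<in>Y \<inter> cball 0 1. \<bar>f y\<bar>)"

lemma norm_on_least:
  fixes f :: "'a::real_normed_vector \<Rightarrow>\<^sub>L real"
  assumes "subspace Y" "\<And>y. y \<in> Y \<Longrightarrow> norm y \<le> 1 \<Longrightarrow> \<bar>f y\<bar> \<le> c"
  shows "norm_on Y f \<le> c"
  unfolding norm_on_def using assms subspace_0[OF assms(1)]
  by (intro cSUP_least) (auto intro: exI[of _ 0])

lemma norm_on_upper:
  fixes f :: "'a::real_normed_vector \<Rightarrow>\<^sub>L real"
  assumes "y \<in> Y" "norm y \<le> 1"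
  shows "\<bar>f y\<bar> \<le> norm_on Y f"
  unfolding norm_on_def
proof (rule cSUP_upper)
  have "\<bar>f z\<bar> \<le> norm f" if "norm z \<le> 1" for z
    using norm_blinfun[of f z] mult_left_le[OF that norm_ge_zero[of f]] by simp
  then show "bdd_above ((\<lambda>y. \<bar>f y\<bar>) ` (Y \<inter> cball 0 1))"
    by (intro bdd_aboveI[of _ "norm f"]) auto
qed (use assms in simp)

lemma abs_le_norm_on:
  fixes f :: "'a::real_normed_vector \<Rightarrow>\<^sub>L real"
  assumes "subspace Y" "y \<in> Y"
  shows "\<bar>f y\<bar> \<le> norm_on Y f * norm y"
proof (cases "y = 0")
  case False
  have "\<bar>f (sgn y)\<bar> \<le> norm_on Y f"
  proof (rule norm_on_upper)
    show "sgn y \<in> Y"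
      using subspace_scale[OF assms] by (simp add: sgn_div_norm)
  qed (simp add: norm_sgn)
  then show ?thesis
    using False by (simp add: sgn_div_norm blinfun.scaleR_right abs_mult field_simps)
qed simp

lemma norm_on_nonneg: "subspace Y \<Longrightarrow> 0 \<le> norm_on Y f"
  using norm_on_upper[of 0 Y f] by (simp add: subspace_0)

lemma norm_on_le_norm: "subspace Y \<Longrightarrow> norm_on Y f \<le> norm f"
proof (rule norm_on_least)
  fix y :: 'a
  assume "norm y \<le> 1"
  then show "\<bar>f y\<bar> \<le> norm f"
    using norm_blinfun[of f y] mult_left_le[of "norm y" "norm f"] by simp
qed

lemma norm_on_triangle:
  assumes "subspace Y"
  shows "norm_on Y (f + g) \<le> norm_on Y f + norm_on Y g"
proof (rule norm_on_least[OF assms])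
  fix y
  assume "y \<in> Y" "norm y \<le> 1"
  then show "\<bar>(f + g) y\<bar> \<le> norm_on Y f + norm_on Y g"
    using norm_on_upper[of y Y f] norm_on_upper[of y Y g] by (simp add: blinfun.add_left)
qed

lemma norm_on_scaleR:
  assumes "subspace Y"
  shows "norm_on Y (t *\<^sub>R f) = \<bar>t\<bar> * norm_on Y f"
proof -
  have le: "norm_on Y (s *\<^sub>R g) \<le> \<bar>s\<bar> * norm_on Y g" for s g
  proof (rule norm_on_least[OF assms])
    fix y
    assume "y \<in> Y" "norm y \<le> 1"
    then show "\<bar>(s *\<^sub>R g) y\<bar> \<le> \<bar>s\<bar> * norm_on Y g"
      using norm_on_upper[of y Y g] by (simp add: blinfun.scaleR_left abs_mult mult_left_mono)
  qed
  show ?thesis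
  proof (cases "t = 0")
    case True
    then show ?thesis
      using norm_on_nonneg[OF assms, of 0] le[of 0 0] by simp
  next
    case False
    have "norm_on Y ((1 / t) *\<^sub>R (t *\<^sub>R f)) \<le> \<bar>1 / t\<bar> * norm_on Y (t *\<^sub>R f)"
      by (rule le)
    then have "\<bar>t\<bar> * norm_on Y f \<le> norm_on Y (t *\<^sub>R f)"
      using False by (simp add: field_simps)
    then show ?thesis
      using le[of t f] by simp
  qed
qed

lemma norm_on_minus_commute: "subspace Y \<Longrightarrow> norm_on Y (f - g) = norm_on Y (g - f)"
  using norm_on_scaleR[of Y "- 1" "f - g"] by simp

lemma sublinear_norm_on: "subspace Y \<Longrightarrow> sublinear (norm_on Y)"
  by (rule sublinearI) (simp_all add: norm_on_triangle norm_on_scaleR)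

text \<open>
  The rational span of norming functionals \<open>\<Phi> d\<close> for \<open>d \<in> D\<close> is dense. Otherwise a nonzero functional on the
  dual that is bounded by \<open>norm_on (closure D)\<close> vanishes on it. By reflexivity this functional is evaluation at
  some \<open>x\<close>; the bound puts \<open>x\<close> into \<open>closure D\<close>, and \<open>\<Phi> d x = 0\<close> for points \<open>d\<close> near \<open>x\<close> forces \<open>x = 0\<close>.
\<close>

lemma separable_dual_of_reflexive:
  fixes D :: "'a::real_normed_vector set"
  assumes refl: "reflexive_space TYPE('a)" and D: "countable D" "subspace (closure D)"
  obtains G where "countable G"
    "\<And>f \<eta>. 0 < \<eta> \<Longrightarrow> \<exists>g\<in>G. norm_on (closure D) (f - g) < \<eta>"
proof -
  define Y where "Y = closure D"
  have Y: "subspace Y" "closed Y"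
    using D by (simp_all add: Y_def)
  have "\<forall>d. \<exists>F :: 'a \<Rightarrow>\<^sub>L real. norm F \<le> 1 \<and> blinfun_apply F d = norm d"
    using norming_functional by metis
  then obtain \<Phi> :: "'a \<Rightarrow> 'a \<Rightarrow>\<^sub>L real" where \<Phi>: "\<And>d. norm (\<Phi> d) \<le> 1" "\<And>d. \<Phi> d d = norm d"
    by metis
  have h: "countable ((\<lambda>(q, r). q *\<^sub>R a + r *\<^sub>R b) ` (\<rat> \<times> \<rat>))" for a b :: "'a \<Rightarrow>\<^sub>L real"
    using countable_rat by (intro countable_image countable_SIGMA) auto
  have "countable (insert 0 (\<Phi> ` D))"
    using D by simp
  then have "\<exists>G. insert 0 (\<Phi> ` D) \<subseteq> G \<and> countable G \<and>
    (\<forall>a\<in>G. \<forall>b\<in>G. (\<lambda>(q, r). q *\<^sub>R a + r *\<^sub>R b) ` (\<rat> \<times> \<rat>) \<subseteq> G)"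
    by (rule countable_set_closed_under) (rule h)
  then obtain G where G: "insert 0 (\<Phi> ` D) \<subseteq> G" "countable G"
    "\<forall>a\<in>G. \<forall>b\<in>G. (\<lambda>(q, r). q *\<^sub>R a + r *\<^sub>R b) ` (\<rat> \<times> \<rat>) \<subseteq> G"
    by (elim exE conjE)
  have sub: "subspace (closure G)"
  proof (rule subspace_closure_rational)
    show "q *\<^sub>R a + r *\<^sub>R b \<in> G" if "a \<in> G" "b \<in> G" "q \<in> \<rat>" "r \<in> \<rat>" for a b q r
      using G(3) that by (auto simp: image_subset_iff)
  qed (use G in auto)
  have "\<exists>g\<in>G. norm_on Y (f - g) < \<eta>" if \<eta>: "0 < \<eta>" for f \<eta>
  proof -
    have "\<exists>v\<in>closure G. norm_on Y (f - v) < \<eta> / 2"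
    proof (rule ccontr)
      assume "\<not> ?thesis"
      then have sep: "\<eta> / 2 \<le> norm_on Y (f - v)" if "v \<in> closure G" for v
        using that by force
      obtain \<Lambda> :: "('a \<Rightarrow>\<^sub>L real) \<Rightarrow>\<^sub>L real" where \<Lambda>: "\<And>g. \<Lambda> g \<le> norm_on Y g"
        "\<And>v. v \<in> closure G \<Longrightarrow> \<Lambda> v = 0" "\<eta> / 2 \<le> \<Lambda> f"
        using hahn_banach_separation[OF sub sublinear_norm_on[OF Y(1)], of 1 "\<eta> / 2" f]
          norm_on_nonneg[OF Y(1)] norm_on_le_norm[OF Y(1)] sep by (metis mult_1)
      have "\<Lambda> g \<le> 1 * norm g" for g
        using \<Lambda>(1)[of g] norm_on_le_norm[OF Y(1), of g] by simp
      then obtain x where x: "\<And>g. \<Lambda> g = g x"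
        using reflexive_representation[OF refl, of "blinfun_apply \<Lambda>" 1]
          bounded_linear.linear[OF blinfun.bounded_linear_right] by blast
      have "x \<in> Y"
      proof (rule in_closed_subspace_if_annihilated[OF Y])
        fix F :: "'a \<Rightarrow>\<^sub>L real"
        assume F: "\<And>v. v \<in> Y \<Longrightarrow> F v = 0"
        have "norm_on Y F \<le> 0" "norm_on Y (- F) \<le> 0"
          using F by (auto intro!: norm_on_least[OF Y(1)] simp: blinfun.minus_left)
        then show "F x = 0"
          using \<Lambda>(1)[of F] \<Lambda>(1)[of "- F"] by (simp add: x blinfun.minus_left)
      qed
      have "norm x \<le> e" if e: "0 < e" for e
      proof -
        obtain d where d: "d \<in> D" "dist d x < e / 2"
          using \<open>x \<in> Y\<close> e unfolding Y_def closure_approachable by (metis half_gt_zero)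
        have "\<Phi> d x = 0"
          using \<Lambda>(2)[of "\<Phi> d"] d(1) G(1) closure_subset[of G] by (auto simp: x)
        then have "norm d = \<Phi> d (d - x)"
          using \<Phi>(2)[of d] by (simp add: blinfun.diff_right)
        also have "\<dots> \<le> norm (\<Phi> d) * norm (d - x)"
          using norm_blinfun[of "\<Phi> d" "d - x"] by simp
        also have "\<dots> \<le> 1 * norm (d - x)"
          by (intro mult_right_mono \<Phi>) simp
        finally show ?thesis
          using d(2) norm_triangle_ineq4[of d "d - x"] by (simp add: dist_norm)
      qed
      then have "x = 0"
        using field_le_epsilon[of "norm x" 0] by simp
      then show False
        using \<Lambda>(3) \<eta> by (simp add: x)
    qed
    then obtain v where v: "v \<in> closure G" "norm_on Y (f - v) < \<eta> / 2"
      by blast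
    obtain g where g: "g \<in> G" "dist g v < \<eta> / 2"
      using v(1) \<eta> unfolding closure_approachable by (metis half_gt_zero)
    have "norm_on Y (f - g) \<le> norm_on Y (f - v) + norm_on Y (v - g)"
      using norm_on_triangle[OF Y(1), of "f - v" "v - g"] by simp
    also have "\<dots> < \<eta>"
      using v(2) g(2) norm_on_le_norm[OF Y(1), of "v - g"] by (simp add: dist_norm norm_minus_commute)
    finally show ?thesis
      using g(1) by blast
  qed
  then show thesis
    using that G(2) by (simp add: Y_def)
qed

text \<open>
  A subsequence converges under countably many functionals that are dense on \<open>closure D\<close>, hence under all
  functionals. The limits define a bounded functional on the dual, which reflexivity represents by a point.
\<close>

lemma weakly_convergent_subsequence:
  fixes D :: "'a::real_normed_vector set" and u :: "nat \<Rightarrow> 'a"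
  assumes refl: "reflexive_space TYPE('a)" and D: "countable D" "subspace (closure D)"
    and u: "\<And>n. u n \<in> closure D" "\<And>n. norm (u n) \<le> B"
  obtains r l where "strict_mono r" "weakly_tendsto (u \<circ> r) l"
proof -
  define Y where "Y = closure D"
  have Y: "subspace Y"
    using D by (simp add: Y_def)
  obtain G where G: "countable G" "\<And>f \<eta>. 0 < \<eta> \<Longrightarrow> \<exists>g\<in>G. norm_on Y (f - g) < \<eta>"
    using separable_dual_of_reflexive[OF refl D] unfolding Y_def by blast
  have "G \<noteq> {}"
    using G(2)[of 1 0] by auto
  define g where "g = from_nat_into G"
  have range: "range g = G"
    using G(1) \<open>G \<noteq> {}\<close> by (simp add: g_def range_from_nat_into)
  have B: "0 \<le> B"
    by (rule order.trans[OF norm_ge_zero u(2)[of 0]])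
  have bnd: "\<bar>f (u n)\<bar> \<le> norm f * B" for f :: "'a \<Rightarrow>\<^sub>L real" and n
    using norm_blinfun[of f "u n"] mult_left_mono[OF u(2)[of n] norm_ge_zero[of f]] by simp
  obtain r l where r: "strict_mono r" and l: "\<And>j. (\<lambda>n. g j (u (r n))) \<longlonglongrightarrow> l j"
    using bounded_real_sequences_subseq[of "\<lambda>n j. g j (u n)" "\<lambda>j. norm (g j) * B"] bnd by blast
  have conv: "convergent (\<lambda>n. f (u (r n)))" for f :: "'a \<Rightarrow>\<^sub>L real"
  proof (rule Cauchy_convergent, rule metric_CauchyI)
    fix e :: real
    assume e: "0 < e"
    define \<eta> where "\<eta> = e / (3 * (B + 1))"
    have \<eta>: "0 < \<eta>" "\<eta> * B \<le> e / 3"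
      using e B by (auto simp: \<eta>_def field_simps)
    obtain j where j: "norm_on Y (f - g j) < \<eta>"
      using G(2)[OF \<eta>(1), of f] range by blast
    have close: "\<bar>f (u n) - g j (u n)\<bar> \<le> e / 3" for n
    proof -
      have "\<bar>(f - g j) (u n)\<bar> \<le> norm_on Y (f - g j) * norm (u n)"
        by (rule abs_le_norm_on[OF Y]) (simp add: Y_def u)
      also have "\<dots> \<le> \<eta> * B"
        using j u(2)[of n] \<eta>(1) by (intro mult_mono) auto
      finally show ?thesis
        using \<eta>(2) by (simp add: blinfun.diff_left)
    qed
    have "Cauchy (\<lambda>n. g j (u (r n)))"
      using l[of j] by (rule LIMSEQ_imp_Cauchy)
    then obtain N where N: "\<And>m n. N \<le> m \<Longrightarrow> N \<le> n \<Longrightarrow> dist (g j (u (r m))) (g j (u (r n))) < e / 3"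
      using e metric_CauchyD[of "\<lambda>n. g j (u (r n))" "e / 3"] by auto
    have "dist (f (u (r m))) (f (u (r n))) < e" if "N \<le> m" "N \<le> n" for m n
      using N[OF that] close[of "r m"] close[of "r n"] unfolding dist_real_def by linarith
    then show "\<exists>N. \<forall>m\<ge>N. \<forall>n\<ge>N. dist (f (u (r m))) (f (u (r n))) < e"
      by blast
  qed
  define \<Lambda> where "\<Lambda> f = lim (\<lambda>n. f (u (r n)))" for f :: "'a \<Rightarrow>\<^sub>L real"
  have \<Lambda>: "(\<lambda>n. f (u (r n))) \<longlonglongrightarrow> \<Lambda> f" for f :: "'a \<Rightarrow>\<^sub>L real"
    using conv[of f] by (simp add: \<Lambda>_def convergent_LIMSEQ_iff)
  have "linear \<Lambda>"
  proof (rule linearI)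
    show "\<Lambda> (f + f') = \<Lambda> f + \<Lambda> f'" for f f'
      using tendsto_add[OF \<Lambda>[of f] \<Lambda>[of f']] \<Lambda>[of "f + f'"]
      by (simp add: blinfun.add_left LIMSEQ_unique)
    show "\<Lambda> (t *\<^sub>R f) = t *\<^sub>R \<Lambda> f" for t f
      using tendsto_mult[OF tendsto_const[of t] \<Lambda>[of f]] \<Lambda>[of "t *\<^sub>R f"]
      by (simp add: blinfun.scaleR_left LIMSEQ_unique)
  qed
  moreover have "\<Lambda> f \<le> B * norm f" for f :: "'a \<Rightarrow>\<^sub>L real"
  proof (rule LIMSEQ_le_const2[OF \<Lambda>])
    show "\<exists>N. \<forall>n\<ge>N. f (u (r n)) \<le> B * norm f"
      using bnd[of f] by (auto simp: abs_le_iff mult.commute)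
  qed
  ultimately obtain x where x: "\<And>f. \<Lambda> f = blinfun_apply f x"
    using reflexive_representation[OF refl] by blast
  have "weakly_tendsto (u \<circ> r) x"
    using \<Lambda> x by (simp add: weakly_tendsto_def)
  then show thesis
    using that r by blast
qed

section \<open>A Frechet smooth function on a separable subspace\<close>

lemma power2_midpoint_le:
  fixes a b c :: real
  assumes "0 \<le> c" "c \<le> (a + b) / 2"
  shows "c\<^sup>2 \<le> (a\<^sup>2 + b\<^sup>2) / 2 - (a - b)\<^sup>2 / 4"
proof -
  have "c\<^sup>2 \<le> ((a + b) / 2)\<^sup>2"
    using assms by (intro power_mono) auto
  also have "\<dots> = (a\<^sup>2 + b\<^sup>2) / 2 - (a - b)\<^sup>2 / 4"
    by (simp add: power2_eq_square field_simps)
  finally show ?thesis .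
qed

text \<open>
  The function \<open>gauge\<close> below lies within \<open>1\<close> of the norm from below and has, at every point, a Frechet
  superderivative along \<open>Y\<close> of norm at most \<open>1\<close>. Such an upper expansion is what a minimum condition uses.
\<close>

locale dual_dense_sequence =
  fixes Y :: "'a::real_normed_vector set" and g :: "nat \<Rightarrow> 'a \<Rightarrow>\<^sub>L real"
  assumes subspace: "subspace Y"
    and bound: "\<And>j. norm_on Y (g j) \<le> 2"
    and dense: "\<And>f \<eta>. norm f \<le> 1 \<Longrightarrow> 0 < \<eta> \<Longrightarrow> \<exists>j. norm_on Y (f - g j) < \<eta>"
begin

text \<open>
  The factor \<open>1 / 9\<close> makes \<open>penalty f \<le> 1\<close> on the dual unit ball, where \<open>norm_on Y (f - g j) \<le> 3\<close>.
\<close>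

definition weight :: "nat \<Rightarrow> real" where
  "weight j = (1 / 2) ^ Suc j / 9"

definition penalty :: "('a \<Rightarrow>\<^sub>L real) \<Rightarrow> real" where
  "penalty f = (\<Sum>j. weight j * (norm_on Y (f - g j))\<^sup>2)"

text \<open>
  Up to the restriction to the unit ball, which makes \<open>gauge\<close> Lipschitz with constant \<open>1\<close>, this is the convex
  conjugate of \<open>penalty\<close>.
\<close>

definition gauge :: "'a \<Rightarrow> real" where
  "gauge x = (SUP f\<in>cball 0 1. blinfun_apply f x - penalty f)"

lemma weight_pos: "0 < weight j"
  by (simp add: weight_def)

lemma weight_sums: "(\<lambda>j. weight j * 9) sums 1"
  using power_half_series by (simp add: weight_def)

lemma term_nonneg: "0 \<le> weight j * (norm_on Y (f - g j))\<^sup>2"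
  using weight_pos[of j] by simp

lemma norm_on_diff_le:
  assumes "norm f \<le> 1"
  shows "norm_on Y (f - g j) \<le> 3"
proof -
  have "norm_on Y (f - g j) \<le> norm_on Y f + norm_on Y (- 1 *\<^sub>R g j)"
    using norm_on_triangle[OF subspace, of f "- 1 *\<^sub>R g j"] by simp
  also have "\<dots> \<le> 1 + 2"
    unfolding norm_on_scaleR[OF subspace] using assms bound[of j] norm_on_le_norm[OF subspace, of f] by simp
  finally show ?thesis
    by simp
qed

lemma term_le: "norm f \<le> 1 \<Longrightarrow> weight j * (norm_on Y (f - g j))\<^sup>2 \<le> weight j * 9"
  using power_mono[OF norm_on_diff_le norm_on_nonneg[OF subspace], of f j 2] weight_pos[of j] by simp

lemma summable_penalty:
  assumes "norm f \<le> 1"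
  shows "summable (\<lambda>j. weight j * (norm_on Y (f - g j))\<^sup>2)"
  by (rule summable_comparison_test'[OF sums_summable[OF weight_sums], of 0])
    (use term_le[OF assms] term_nonneg in auto)

lemma penalty_nonneg: "norm f \<le> 1 \<Longrightarrow> 0 \<le> penalty f"
  unfolding penalty_def by (rule suminf_nonneg[OF summable_penalty term_nonneg])

lemma penalty_le_1: "norm f \<le> 1 \<Longrightarrow> penalty f \<le> 1"
  unfolding penalty_def using suminf_le[OF term_le summable_penalty sums_summable[OF weight_sums], of f] sums_unique[OF weight_sums]
  by simp

text \<open>
  The defect of midpoint convexity of \<open>penalty\<close> controls the difference of the distances from \<open>f\<close> and \<open>f'\<close> to
  each single \<open>g i\<close>.
\<close>

lemma penalty_midpoint:
  assumes f: "norm f \<le> 1" and f': "norm f' \<le> 1"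
  shows "penalty ((1 / 2) *\<^sub>R (f + f')) + weight i * (norm_on Y (f - g i) - norm_on Y (f' - g i))\<^sup>2 / 4 \<le> (penalty f + penalty f') / 2"
proof -
  define s where "s f j = norm_on Y (f - g j)" for f j
  define m where "m = (1 / 2) *\<^sub>R (f + f')"
  have m: "norm m \<le> 1"
    using norm_triangle_ineq[of f f'] f f' by (simp add: m_def)
  define c where "c = weight i * (s f i - s f' i)\<^sup>2 / 4"
  have s_mid: "s m j \<le> (s f j + s f' j) / 2" for j
  proof -
    have "m - g j = (1 / 2) *\<^sub>R ((f - g j) + (f' - g j))"
      by (simp add: m_def algebra_simps flip: scaleR_add_left)
    then have "s m j = 1 / 2 * norm_on Y ((f - g j) + (f' - g j))"
      by (simp add: s_def norm_on_scaleR[OF subspace])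
    then show ?thesis
      using norm_on_triangle[OF subspace, of "f - g j" "f' - g j"] by (simp add: s_def)
  qed
  have le: "weight j * (s m j)\<^sup>2 + (if j = i then c else 0) \<le> (weight j * (s f j)\<^sup>2 + weight j * (s f' j)\<^sup>2) / 2" for j
  proof -
    have "(s m j)\<^sup>2 \<le> ((s f j)\<^sup>2 + (s f' j)\<^sup>2) / 2 - (s f j - s f' j)\<^sup>2 / 4"
      by (rule power2_midpoint_le[OF _ s_mid]) (simp add: s_def norm_on_nonneg[OF subspace])
    from mult_left_mono[OF this less_imp_le[OF weight_pos[of j]]]
    have *: "weight j * (s m j)\<^sup>2 + weight j * (s f j - s f' j)\<^sup>2 / 4 \<le> (weight j * (s f j)\<^sup>2 + weight j * (s f' j)\<^sup>2) / 2"
      by (simp add: algebra_simps)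
    have "0 \<le> weight j * (s f j - s f' j)\<^sup>2 / 4"
      using weight_pos[of j] by simp
    then show ?thesis
      using * by (auto simp: c_def)
  qed
  have sum: "(\<lambda>j. weight j * (s h j)\<^sup>2) sums penalty h" if "norm h \<le> 1" for h
    using summable_sums[OF summable_penalty[OF that]] by (simp add: s_def penalty_def)
  have "penalty m + c \<le> (penalty f + penalty f') / 2"
    using le sums_add[OF sum[OF m] sums_single[of i "\<lambda>_. c"]] sums_divide[OF sums_add[OF sum[OF f] sum[OF f']], of 2]
    by (rule sums_le)
  then show ?thesis
    by (simp add: m_def c_def s_def)
qed

lemma gauge_upper:
  assumes "norm f \<le> 1"
  shows "blinfun_apply f x - penalty f \<le> gauge x"
  unfolding gauge_def
proof (rule cSUP_upper)
  have "blinfun_apply h x - penalty h \<le> norm x" if "norm h \<le> 1" for h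
    using norm_blinfun[of h x] mult_right_mono[OF that norm_ge_zero[of x]] penalty_nonneg[OF that] by simp
  then show "bdd_above ((\<lambda>f. blinfun_apply f x - penalty f) ` cball 0 1)"
    by (intro bdd_aboveI[of _ "norm x"]) auto
qed (use assms in simp)

lemma gauge_zero_le: "gauge 0 \<le> 0"
  unfolding gauge_def by (rule cSUP_least) (use penalty_nonneg in auto)

lemma gauge_ge: "norm x - 1 \<le> gauge x"
proof -
  obtain F :: "'a \<Rightarrow>\<^sub>L real" where F: "norm F \<le> 1" "F x = norm x"
    by (rule norming_functional)
  then show ?thesis
    using gauge_upper[OF F(1), of x] penalty_le_1[OF F(1)] by simp
qed

text \<open>
  Take a maximising sequence along which the values at \<open>x\<close> and all distances to the \<open>g j\<close> converge, and a linear
  functional \<open>f\<close> that respects every upper bound which holds eventually along the sequence. Then \<open>f x\<close> is the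
  limit of the values, and the distances of \<open>f\<close> are at most the limits of the distances, so the penalty does not
  increase in the limit.
\<close>

lemma gauge_attained:
  obtains f where "norm f \<le> 1" "gauge x = blinfun_apply f x - penalty f"
proof -
  have "\<exists>f. norm f \<le> 1 \<and> gauge x - 1 / real (Suc k) < blinfun_apply f x - penalty f" for k
  proof -
    have "gauge x - 1 / real (Suc k) < (SUP f\<in>cball 0 1. blinfun_apply f x - penalty f)"
      by (simp add: gauge_def)
    moreover have "bdd_above ((\<lambda>f. blinfun_apply f x - penalty f) ` cball 0 1)"
      using gauge_upper[of _ x] by (intro bdd_aboveI[of _ "gauge x"]) auto
    ultimately show ?thesis
      by (subst (asm) less_cSUP_iff) auto
  qed
  then obtain F where F: "\<And>k. norm (F k) \<le> 1"
    "\<And>k. gauge x - 1 / real (Suc k) < blinfun_apply (F k) x - penalty (F k)"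
    by metis
  define u where "u k j = (case j of 0 \<Rightarrow> F k x | Suc i \<Rightarrow> norm_on Y (F k - g i))" for k j
  have "\<bar>u k j\<bar> \<le> norm x + 3" for k j
  proof (cases j)
    case 0
    then show ?thesis
      using norm_blinfun[of "F k" x] mult_right_mono[OF F(1)[of k] norm_ge_zero[of x]] by (simp add: u_def)
  next
    case (Suc i)
    then show ?thesis
      using norm_on_diff_le[OF F(1), of k i] norm_on_nonneg[OF subspace, of "F k - g i"] norm_ge_zero[of x]
      by (simp add: u_def add_increasing)
  qed
  then obtain r l where r: "strict_mono r" and l: "\<And>j. (\<lambda>k. u (r k) j) \<longlonglongrightarrow> l j"
    using bounded_real_sequences_subseq[of u "\<lambda>_. norm x + 3"] by blast
  have lim_x: "(\<lambda>k. F (r k) x) \<longlonglongrightarrow> l 0"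
    using l[of 0] by (simp add: u_def)
  have lim_s: "(\<lambda>k. norm_on Y (F (r k) - g j)) \<longlonglongrightarrow> l (Suc j)" for j
    using l[of "Suc j"] by (simp add: u_def)
  define \<C> where "\<C> = {(y, a). eventually (\<lambda>k. F (r k) y \<le> a) sequentially}"
  obtain n where n: "linear n" "\<And>z. n z \<le> norm z" "\<And>y a. (y, a) \<in> \<C> \<Longrightarrow> n y \<le> a"
  proof (rule dominated_functional_fip[of \<C> norm])
    fix \<F>
    assume \<F>: "finite \<F>" "\<F> \<subseteq> \<C>"
    then have "eventually (\<lambda>k. \<forall>e\<in>\<F>. F (r k) (fst e) \<le> snd e) sequentially"
      by (intro eventually_ball_finite) (auto simp: \<C>_def)
    then obtain k where k: "\<forall>e\<in>\<F>. F (r k) (fst e) \<le> snd e"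
      using eventually_happens'[OF sequentially_bot] by blast
    have "F (r k) z \<le> norm z" for z
      using norm_blinfun[of "F (r k)" z] mult_right_mono[OF F(1)[of "r k"] norm_ge_zero[of z]] by simp
    then show "\<exists>n. linear n \<and> (\<forall>x. n x \<le> norm x) \<and> (\<forall>(y, a)\<in>\<F>. n y \<le> a)"
      using k bounded_linear.linear[OF blinfun.bounded_linear_right]
      by (intro exI[of _ "blinfun_apply (F (r k))"]) auto
  qed blast
  obtain f where f: "\<And>z. blinfun_apply f z = n z"
    using blinfun_of_dominated[OF n(1), of 1] n(2) by auto
  have f1: "norm f \<le> 1"
  proof (rule norm_blinfun_bound)
    show "norm (f z) \<le> 1 * norm z" for z
      using n(2)[of z] n(2)[of "- z"] linear_neg[OF n(1), of z] by (simp add: f)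
  qed simp
  have limit_le: "f y \<le> a" if "eventually (\<lambda>k. F (r k) y \<le> a) sequentially" for y a
    using n(3)[of y a] that by (simp add: f \<C>_def)
  have fx: "l 0 \<le> f x"
  proof (rule field_le_epsilon)
    fix e :: real
    assume "0 < e"
    then have "eventually (\<lambda>k. l 0 - e < F (r k) x) sequentially"
      using lim_x by (intro order_tendstoD) auto
    then have "eventually (\<lambda>k. F (r k) (- x) \<le> - (l 0 - e)) sequentially"
      by (rule eventually_mono) (simp add: blinfun.minus_right)
    from limit_le[OF this] show "l 0 \<le> f x + e"
      by (simp add: blinfun.minus_right)
  qed
  have fs: "norm_on Y (f - g j) \<le> l (Suc j)" for j
  proof (rule norm_on_least[OF subspace])
    fix y
    assume y: "y \<in> Y" "norm y \<le> 1"
    have le: "(f - g j) z \<le> l (Suc j)" if z: "z \<in> Y" "norm z \<le> 1" for z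
    proof (rule field_le_epsilon)
      fix e :: real
      assume "0 < e"
      then have "eventually (\<lambda>k. norm_on Y (F (r k) - g j) < l (Suc j) + e) sequentially"
        using lim_s by (intro order_tendstoD) auto
      then have "eventually (\<lambda>k. F (r k) z \<le> g j z + l (Suc j) + e) sequentially"
      proof (rule eventually_mono)
        show "F (r k) z \<le> g j z + l (Suc j) + e" if "norm_on Y (F (r k) - g j) < l (Suc j) + e" for k
          using that norm_on_upper[OF z, of "F (r k) - g j"] by (simp add: blinfun.diff_left abs_le_iff)
      qed
      from limit_le[OF this] show "(f - g j) z \<le> l (Suc j) + e"
        by (simp add: blinfun.diff_left)
    qed
    show "\<bar>(f - g j) y\<bar> \<le> l (Suc j)"
      using le[OF y] le[of "- y"] y subspace_neg[OF subspace] by (simp add: blinfun.minus_right abs_le_iff)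
  qed
  have "penalty f \<le> l 0 - gauge x"
    unfolding penalty_def
  proof (rule suminf_le_const[OF summable_penalty[OF f1]])
    fix J
    have "(\<Sum>j<J. weight j * (norm_on Y (f - g j))\<^sup>2) \<le> (\<Sum>j<J. weight j * (l (Suc j))\<^sup>2)"
      using fs norm_on_nonneg[OF subspace] weight_pos
      by (intro sum_mono mult_left_mono power_mono) (auto intro: less_imp_le)
    also have "\<dots> \<le> l 0 - gauge x"
    proof (rule LIMSEQ_le)
      show "(\<lambda>k. \<Sum>j<J. weight j * (norm_on Y (F (r k) - g j))\<^sup>2) \<longlonglongrightarrow> (\<Sum>j<J. weight j * (l (Suc j))\<^sup>2)"
        by (intro tendsto_intros lim_s)
      have "(\<lambda>k. 1 / real (Suc (r k))) \<longlonglongrightarrow> 0"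
        using LIMSEQ_subseq_LIMSEQ[OF LIMSEQ_Suc[OF lim_inverse_n'] r]
        by (simp add: o_def)
      then show "(\<lambda>k. F (r k) x - gauge x + 1 / real (Suc (r k))) \<longlonglongrightarrow> l 0 - gauge x"
        using tendsto_add[OF tendsto_diff[OF lim_x tendsto_const[of "gauge x"]]] by fastforce
      have "(\<Sum>j<J. weight j * (norm_on Y (F (r k) - g j))\<^sup>2) \<le> F (r k) x - gauge x + 1 / real (Suc (r k))" for k
      proof -
        have "(\<Sum>j<J. weight j * (norm_on Y (F (r k) - g j))\<^sup>2) \<le> penalty (F (r k))"
          unfolding penalty_def by (rule sum_le_suminf[OF summable_penalty[OF F(1)]]) (use term_nonneg in auto)
        then show ?thesis
          using F(2)[of "r k"] by simp
      qed
      then show "\<exists>N. \<forall>k\<ge>N. (\<Sum>j<J. weight j * (norm_on Y (F (r k) - g j))\<^sup>2) \<le> F (r k) x - gauge x + 1 / real (Suc (r k))"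
        by blast
    qed
    finally show "(\<Sum>j<J. weight j * (norm_on Y (f - g j))\<^sup>2) \<le> l 0 - gauge x" .
  qed
  then have "gauge x = f x - penalty f"
    using fx gauge_upper[OF f1, of x] by simp
  then show thesis
    using that f1 by blast
qed

text \<open>
  The superderivative is a maximiser \<open>f\<close> at \<open>x\<close>. A maximiser \<open>f'\<close> at \<open>x + h\<close> is optimal at \<open>x\<close> up to \<open>2 * norm h\<close>,
  so \<open>penalty_midpoint\<close> gives nearly equal distances from \<open>f\<close> and \<open>f'\<close> to a \<open>g j\<close> chosen close to \<open>f\<close>. Hence \<open>f'\<close>
  is close to \<open>f\<close> on \<open>Y\<close>, and \<open>gauge (x + h) \<le> gauge x + f' h\<close>.
\<close>

lemma gauge_superdifferentiable:
  obtains f where "norm f \<le> 1"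
    "\<And>\<eta>. 0 < \<eta> \<Longrightarrow> \<exists>\<delta>>0. \<forall>h\<in>Y. norm h < \<delta> \<longrightarrow> gauge (x + h) \<le> gauge x + blinfun_apply f h + \<eta> * norm h"
proof -
  obtain f where f: "norm f \<le> 1" "gauge x = blinfun_apply f x - penalty f"
    by (rule gauge_attained)
  have "\<exists>\<delta>>0. \<forall>h\<in>Y. norm h < \<delta> \<longrightarrow> gauge (x + h) \<le> gauge x + f h + \<eta> * norm h" if \<eta>: "0 < \<eta>" for \<eta>
  proof -
    obtain j where j: "norm_on Y (f - g j) < \<eta> / 3"
      using dense[OF f(1), of "\<eta> / 3"] \<eta> by auto
    \<comment> \<open>Chosen such that \<open>weight j * t\<^sup>2 / 4 < \<delta>\<close> implies \<open>\<bar>t\<bar> < \<eta> / 3\<close>.\<close>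
    define \<delta> where "\<delta> = weight j * (\<eta> / 3)\<^sup>2 / 4"
    have "gauge (x + h) \<le> gauge x + f h + \<eta> * norm h" if h: "h \<in> Y" "norm h < \<delta>" for h
    proof -
      obtain f' where f': "norm f' \<le> 1" "gauge (x + h) = blinfun_apply f' (x + h) - penalty f'"
        by (rule gauge_attained)
      have small: "\<bar>k h\<bar> \<le> norm h" if "norm k \<le> 1" for k :: "'a \<Rightarrow>\<^sub>L real"
        using norm_blinfun[of k h] mult_right_mono[OF that norm_ge_zero[of h]] by simp
      have near: "gauge x - 2 * norm h \<le> f' x - penalty f'"
        using gauge_upper[OF f(1), of "x + h"] f(2) f'(2) small[OF f(1)] small[OF f'(1)]
        by (simp add: blinfun.add_right abs_le_iff)
      define m where "m = (1 / 2) *\<^sub>R (f + f')"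
      define c where "c = weight j * (norm_on Y (f - g j) - norm_on Y (f' - g j))\<^sup>2 / 4"
      have "norm m \<le> 1"
        using norm_triangle_ineq[of f f'] f f' by (simp add: m_def)
      then have "m x - penalty m \<le> gauge x"
        by (rule gauge_upper)
      moreover have "blinfun_apply m x = (f x + f' x) / 2"
        by (simp add: m_def blinfun.add_left blinfun.scaleR_left)
      moreover have "penalty m + c \<le> (penalty f + penalty f') / 2"
        using penalty_midpoint[OF f(1) f'(1), of j] by (simp add: m_def c_def)
      ultimately have "c \<le> (penalty f + penalty f') / 2 - (blinfun_apply f x + blinfun_apply f' x) / 2 + gauge x"
        by linarith
      also have "\<dots> = (gauge x - (blinfun_apply f' x - penalty f')) / 2"
        using f(2) by (simp add: field_simps)
      also have "\<dots> \<le> norm h"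
        using near by simp
      finally have "c \<le> norm h" .
      also have "\<dots> < weight j * (\<eta> / 3)\<^sup>2 / 4"
        using h(2) by (simp add: \<delta>_def)
      finally have "weight j * (norm_on Y (f - g j) - norm_on Y (f' - g j))\<^sup>2 < weight j * (\<eta> / 3)\<^sup>2"
        by (simp add: c_def)
      then have "(norm_on Y (f - g j) - norm_on Y (f' - g j))\<^sup>2 < (\<eta> / 3)\<^sup>2"
        using weight_pos[of j] by simp
      then have "\<bar>norm_on Y (f - g j) - norm_on Y (f' - g j)\<bar> < \<eta> / 3"
        using \<eta> power2_less_imp_less[of "\<bar>norm_on Y (f - g j) - norm_on Y (f' - g j)\<bar>" "\<eta> / 3"] by simp
      then have "norm_on Y (f' - g j) < 2 * \<eta> / 3"
        using j by linarith
      then have "norm_on Y (f' - f) \<le> \<eta>"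
        using j norm_on_triangle[OF subspace, of "f' - g j" "g j - f"] norm_on_minus_commute[OF subspace, of f "g j"]
        by simp
      then have "norm_on Y (f' - f) * norm h \<le> \<eta> * norm h"
        by (rule mult_right_mono) simp
      then have "f' h - f h \<le> \<eta> * norm h"
        using abs_le_norm_on[OF subspace h(1), of "f' - f"] by (simp add: blinfun.diff_left)
      moreover have "gauge (x + h) \<le> gauge x + f' h"
        using gauge_upper[OF f'(1), of x] f'(2) by (simp add: blinfun.add_right)
      ultimately show ?thesis
        by simp
    qed
    moreover have "0 < \<delta>"
      using weight_pos[of j] \<eta> by (simp add: \<delta>_def)
    ultimately show ?thesis
      by blast
  qed
  then show thesis
    using that f(1) by blast
qed

lemma gauge_weakly_lsc:
  assumes "weakly_tendsto u l" "0 < e"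
  shows "eventually (\<lambda>n. gauge l - e < gauge (u n)) sequentially"
proof -
  obtain f where f: "norm f \<le> 1" "gauge l = blinfun_apply f l - penalty f"
    by (rule gauge_attained)
  have "(\<lambda>n. f (u n)) \<longlonglongrightarrow> f l"
    using assms(1) by (simp add: weakly_tendsto_def)
  then have "eventually (\<lambda>n. f l - e < f (u n)) sequentially"
    using assms(2) by (intro order_tendstoD) auto
  then show ?thesis
  proof (rule eventually_mono)
    show "gauge l - e < gauge (u n)" if "f l - e < f (u n)" for n
      using that gauge_upper[OF f(1), of "u n"] f(2) by linarith
  qed
qed

end

lemma reflexive_dual_dense_sequence:
  fixes D :: "'a::real_normed_vector set"
  assumes refl: "reflexive_space TYPE('a)" and D: "countable D" "subspace (closure D)"
  obtains g where "dual_dense_sequence (closure D) g"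
proof -
  define Y where "Y = closure D"
  have Y: "subspace Y"
    using D by (simp add: Y_def)
  obtain G where G: "countable G" "\<And>f \<eta>. 0 < \<eta> \<Longrightarrow> \<exists>g\<in>G. norm_on Y (f - g) < \<eta>"
    using separable_dual_of_reflexive[OF refl D] unfolding Y_def by blast
  \<comment> \<open>Functionals of norm at most \<open>1\<close> are approximated up to \<open>1\<close>, so only members of \<open>G\<close> with
    \<open>norm_on\<close> at most \<open>2\<close> matter.\<close>
  define G' where "G' = {g \<in> G. norm_on Y g \<le> 2}"
  have dense: "\<exists>g\<in>G'. norm_on Y (f - g) < \<eta>" if f: "norm f \<le> 1" and "0 < \<eta>" for f \<eta>
  proof -
    obtain g where g: "g \<in> G" "norm_on Y (f - g) < min \<eta> 1"
      using G(2)[of "min \<eta> 1" f] \<open>0 < \<eta>\<close> by auto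
    have "norm_on Y g \<le> norm_on Y f + norm_on Y (g - f)"
      using norm_on_triangle[OF Y, of f "g - f"] by simp
    then have "norm_on Y g \<le> 2"
      using g(2) norm_on_le_norm[OF Y, of f] f norm_on_minus_commute[OF Y, of f g] by simp
    then show ?thesis
      using g by (auto simp: G'_def)
  qed
  have "G' \<noteq> {}" "countable G'"
    using dense[of 0 1] G(1) by (auto simp: G'_def)
  then have range: "range (from_nat_into G') = G'"
    by (simp add: range_from_nat_into)
  have "dual_dense_sequence Y (from_nat_into G')"
  proof
    show "norm_on Y (from_nat_into G' j) \<le> 2" for j
      using from_nat_into[OF \<open>G' \<noteq> {}\<close>, of j] by (simp add: G'_def)
    show "\<exists>j. norm_on Y (f - from_nat_into G' j) < \<eta>" if "norm f \<le> 1" "0 < \<eta>" for f \<eta>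
      using dense[OF that] range by (metis (no_types, lifting) imageE)
  qed (rule Y)
  then show thesis
    using that by (simp add: Y_def)
qed

section \<open>The fuzzy multiplier rule\<close>

text \<open>
  The direct method: a minimising sequence has a weakly convergent subsequence.
\<close>

lemma weakly_lsc_attains_minimum:
  fixes D :: "'a::real_normed_vector set" and J :: "'a \<Rightarrow> real"
  assumes refl: "reflexive_space TYPE('a)" and D: "countable D" "subspace (closure D)"
    and S: "S \<subseteq> closure D" "S \<subseteq> cball a r" "weakly_seq_closed S" "S \<noteq> {}"
    and below: "\<And>z. z \<in> S \<Longrightarrow> b \<le> J z"
    and lsc: "\<And>u l e. weakly_tendsto u l \<Longrightarrow> 0 < e \<Longrightarrow> eventually (\<lambda>n. J l - e < J (u n)) sequentially"
  obtains z where "z \<in> S" "\<And>u. u \<in> S \<Longrightarrow> J z \<le> J u"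
proof -
  define m where "m = (INF z\<in>S. J z)"
  have m: "m \<le> J z" if "z \<in> S" for z
    unfolding m_def by (rule cINF_lower[OF _ that]) (use below in \<open>auto intro!: bdd_belowI[of _ b]\<close>)
  have "\<exists>z\<in>S. J z < m + 1 / real (Suc n)" for n
    using S(4) below unfolding m_def
    by (subst cINF_less_iff[symmetric]) (auto intro!: bdd_belowI[of _ b])
  then obtain u where u: "\<And>n. u n \<in> S" "\<And>n. J (u n) < m + 1 / real (Suc n)"
    by metis
  have "norm (u n) \<le> norm a + r" for n
    using u(1)[of n] S(2) norm_triangle_ineq2[of "u n" a] by (auto simp: dist_norm norm_minus_commute)
  then obtain s l where s: "strict_mono s" "weakly_tendsto (u \<circ> s) l"
    using weakly_convergent_subsequence[OF refl D, of u] u(1) S(1) by blast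
  have "l \<in> S"
    using S(3) s(2) u(1) unfolding weakly_seq_closed_def by (metis comp_apply)
  moreover have "J l \<le> m"
  proof (rule field_le_epsilon)
    fix e :: real
    assume e: "0 < e"
    have lim: "(\<lambda>n. 1 / real (Suc (s n))) \<longlonglongrightarrow> 0"
      using LIMSEQ_subseq_LIMSEQ[OF LIMSEQ_Suc[OF lim_inverse_n'] s(1)] by (simp add: o_def)
    have "eventually (\<lambda>n. 1 / real (Suc (s n)) < e / 2) sequentially"
      by (rule order_tendstoD(2)[OF lim]) (use e in simp)
    moreover have "eventually (\<lambda>n. J l - e / 2 < J ((u \<circ> s) n)) sequentially"
      by (rule lsc[OF s(2)]) (use e in simp)
    ultimately have "eventually (\<lambda>n. J l \<le> m + e) sequentially"
    proof eventually_elim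
      case (elim n)
      then show ?case
        using u(2)[of "s n"] unfolding comp_apply by linarith
    qed
    then show "J l \<le> m + e"
      by simp
  qed
  ultimately show thesis
    using that m order.trans by blast
qed

lemma weakly_tendsto_affine:
  assumes "weakly_tendsto u l"
  shows "weakly_tendsto (\<lambda>n. t *\<^sub>R (u n - a)) (t *\<^sub>R (l - a))"
  using assms unfolding weakly_tendsto_def blinfun.scaleR_right blinfun.diff_right
  by (intro allI tendsto_scaleR tendsto_mult tendsto_diff tendsto_const) (erule spec)

text \<open>
  The penalty argument of the introduction. The functional \<open>\<sigma> c\<close> encodes what the separable reduction has to
  preserve: \<open>n \<le> \<sigma> c\<close> keeps \<open>n\<close> bounded and, since \<open>\<sigma> c w = \<zeta> w + \<epsilon> * norm w\<close> for \<open>A w = 0\<close>, within \<open>\<epsilon>\<close> of \<open>\<zeta>\<close> on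
  the kernel of \<open>A\<close>. The number \<open>c\<close> bounds the norm of the multiplier and depends on the point found; this is why the
  reduction is done for all natural numbers \<open>c\<close> at once.
\<close>

theorem fuzzy_multiplier_rule:
  fixes \<Omega> :: "'a::real_normed_vector set" and A :: "'a \<Rightarrow>\<^sub>L 'b::real_normed_vector"
  assumes refl: "reflexive_space TYPE('a)" and \<Omega>: "weakly_seq_closed \<Omega>"
    and zb: "zb \<in> \<Omega>" "A zb = 0"
    and \<zeta>: "\<zeta> \<in> frechet_normal_cone (\<Omega> \<inter> {z. A z = 0}) zb" and \<epsilon>: "0 < \<epsilon>"
  obtains z n where "z \<in> \<Omega> \<inter> ball zb \<epsilon>" "n \<in> frechet_normal_cone \<Omega> z"
    "\<And>w. A w = 0 \<Longrightarrow> \<bar>n w - \<zeta> w\<bar> \<le> \<epsilon> * norm w"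
proof -
  obtain \<delta> where \<delta>: "0 < \<delta>"
    "\<And>u. u \<in> \<Omega> \<Longrightarrow> A u = 0 \<Longrightarrow> norm (u - zb) < \<delta> \<Longrightarrow> \<zeta> (u - zb) \<le> \<epsilon> / 4 * norm (u - zb)"
    using \<zeta> \<epsilon> unfolding frechet_normal_iff by (force dest: spec[of _ "\<epsilon> / 4"])
  define r where "r = min \<delta> \<epsilon> / 2"
  have r: "0 < r" "r < \<delta>" "r < \<epsilon>"
    using \<delta>(1) \<epsilon> by (auto simp: r_def)
  \<comment> \<open>The bump \<open>\<epsilon> * \<rho> * gauge ((z - zb) / \<rho>)\<close> has slope at most \<open>\<epsilon>\<close> and is at least
    \<open>\<epsilon> * (r - \<rho>)\<close> on the sphere of radius \<open>r\<close>. With \<open>\<rho> = r / 4\<close> this exceeds \<open>\<epsilon> / 4 * r\<close>,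
    which bounds \<open>\<zeta> (z - zb)\<close> for \<open>z\<close> in \<open>\<Omega> \<inter> ker A\<close> within the ball.\<close>
  define \<rho> where "\<rho> = r / 4"
  have \<rho>: "0 < \<rho>"
    using r by (simp add: \<rho>_def)
  define \<sigma> where "\<sigma> c w = \<zeta> w + \<epsilon> * norm w + real c * norm (A w)" for c w
  have \<sigma>_le: "\<sigma> c w \<le> (norm \<zeta> + \<epsilon> + real c * norm A) * norm w" for c w
  proof -
    have "\<zeta> w \<le> norm \<zeta> * norm w"
      using norm_blinfun[of \<zeta> w] by simp
    moreover have "real c * norm (A w) \<le> real c * (norm A * norm w)"
      by (intro mult_left_mono norm_blinfun) simp
    ultimately show ?thesis
      by (simp add: \<sigma>_def algebra_simps)
  qed
  obtain D where D: "countable D" "{zb} \<subseteq> D" "subspace (closure D)"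
    and lift: "\<And>c x n. \<lbrakk>x \<in> closure D; n \<in> frechet_normal_cone (\<Omega> \<inter> closure D) x; \<And>z. n z \<le> \<sigma> c z\<rbrakk>
      \<Longrightarrow> \<exists>n'\<in>frechet_normal_cone \<Omega> x. \<forall>z. n' z \<le> \<sigma> c z"
    by (rule frechet_normal_separable_reduction[of "\<lambda>c. norm \<zeta> + \<epsilon> + real c * norm A" \<sigma> "{zb}" \<Omega>])
      (use \<epsilon> \<sigma>_le in auto)
  define Y where "Y = closure D"
  have Y: "subspace Y" "closed Y" "zb \<in> Y"
    using D closure_subset by (auto simp: Y_def)
  obtain g where "dual_dense_sequence Y g"
    using reflexive_dual_dense_sequence[OF refl D(1,3)] unfolding Y_def by blast
  then interpret dual_dense_sequence Y g .
  define d where "d = from_nat_into D"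
  have d: "range d = D"
    unfolding d_def using D by (intro range_from_nat_into) auto
  \<comment> \<open>Countably many functionals on the range of \<open>A\<close> which together vanish only at \<open>0\<close> on \<open>A ` Y\<close>.\<close>
  have "\<forall>j. \<exists>F :: 'b \<Rightarrow>\<^sub>L real. norm F \<le> 1 \<and> blinfun_apply F (A (d j)) = norm (A (d j))"
    using norming_functional by metis
  then obtain \<Phi> :: "nat \<Rightarrow> 'b \<Rightarrow>\<^sub>L real"
    where \<Phi>: "\<And>j. norm (\<Phi> j) \<le> 1" "\<And>j. \<Phi> j (A (d j)) = norm (A (d j))"
    by metis
  define \<phi> where "\<phi> j = \<Phi> j o\<^sub>L A" for j
  have \<phi>_le: "\<bar>\<phi> j w\<bar> \<le> norm (A w)" for j w
    using norm_blinfun[of "\<Phi> j" "A w"] mult_right_mono[OF \<Phi>(1)[of j] norm_ge_zero[of "A w"]]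
    by (simp add: \<phi>_def)
  have \<phi>_total: "A u = 0" if u: "u \<in> Y" "\<And>j. \<phi> j u = 0" for u
  proof -
    have "norm (A u) \<le> e" if e: "0 < e" for e
    proof -
      define e' where "e' = e / (2 * norm A + 1)"
      have "0 < e'"
        using e by (simp add: e'_def add_nonneg_pos)
      then obtain v where "v \<in> D" "dist v u < e'"
        using u(1) unfolding Y_def closure_approachable by metis
      then obtain j where j: "norm (d j - u) < e'"
        using d by (metis dist_norm imageE)
      have small: "norm (A (d j - u)) \<le> norm A * e'"
        using norm_blinfun[of A "d j - u"] mult_left_mono[OF less_imp_le[OF j] norm_ge_zero[of A]] by simp
      have "norm (A (d j)) = \<phi> j (d j - u)"
        using \<Phi>(2)[of j] u(2)[of j] by (simp add: \<phi>_def blinfun.diff_right)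
      also have "\<dots> \<le> norm A * e'"
        using \<phi>_le[of j "d j - u"] small by simp
      finally have "norm (A u) \<le> 2 * norm A * e'"
        using small norm_triangle_ineq4[of "A (d j)" "A (d j - u)"] by (simp add: blinfun.diff_right)
      also have "\<dots> \<le> (2 * norm A + 1) * e'"
        using \<open>0 < e'\<close> by (intro mult_right_mono) auto
      also have "\<dots> = e"
        using add_nonneg_pos[of "2 * norm A" 1] by (simp add: e'_def)
      finally show ?thesis .
    qed
    then show ?thesis
      using field_le_epsilon[of "norm (A u)" 0] by simp
  qed
  define S where "S = \<Omega> \<inter> Y \<inter> cball zb r"
  have S: "S \<subseteq> closure D" "S \<subseteq> cball zb r" "zb \<in> S"
    using zb Y r by (auto simp: S_def Y_def)
  have S_closed: "weakly_seq_closed S"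
    unfolding weakly_seq_closed_def
  proof (intro allI impI)
    fix u l
    assume *: "(\<forall>n. u n \<in> S) \<and> weakly_tendsto u l"
    then have "l \<in> \<Omega>"
      using \<Omega> unfolding weakly_seq_closed_def S_def by blast
    moreover have "l \<in> Y"
      by (rule weakly_tendsto_closed_subspace[OF Y(1,2), of u]) (use * in \<open>auto simp: S_def\<close>)
    moreover have "l \<in> cball zb r"
      by (rule weakly_tendsto_cball[of u]) (use * in \<open>auto simp: S_def\<close>)
    ultimately show "l \<in> S"
      by (simp add: S_def)
  qed
  define G where "G z = \<epsilon> * \<rho> * gauge ((1 / \<rho>) *\<^sub>R (z - zb))" for z
  define pen where "pen k z = real k * (\<Sum>j<k. (\<phi> j z)\<^sup>2)" for k z
  define J where "J k z = - \<zeta> (z - zb) + pen k z + G z" for k z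
  have G_ge: "\<epsilon> * norm (z - zb) - \<epsilon> * \<rho> \<le> G z" for z
  proof -
    have "norm (z - zb) / \<rho> - 1 \<le> gauge ((1 / \<rho>) *\<^sub>R (z - zb))"
      using gauge_ge[of "(1 / \<rho>) *\<^sub>R (z - zb)"] \<rho> by simp
    from mult_left_mono[OF this, of "\<epsilon> * \<rho>"] show ?thesis
      using \<epsilon> \<rho> by (simp add: G_def algebra_simps)
  qed
  have \<zeta>_le: "\<zeta> (z - zb) \<le> norm \<zeta> * r" if "z \<in> S" for z
  proof -
    have "\<zeta> (z - zb) \<le> norm \<zeta> * norm (z - zb)"
      using norm_blinfun[of \<zeta> "z - zb"] by simp
    also have "\<dots> \<le> norm \<zeta> * r"
      using that by (intro mult_left_mono) (auto simp: S_def dist_norm norm_minus_commute)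
    finally show ?thesis .
  qed
  have pen_nonneg: "0 \<le> pen k z" for k z
    by (simp add: pen_def sum_nonneg)
  have "\<exists>z\<in>S. \<forall>u\<in>S. J k z \<le> J k u" for k
  proof -
    have "eventually (\<lambda>n. J k l - e < J k (u n)) sequentially"
      if u: "weakly_tendsto u l" and e: "0 < e" for u l e
    proof -
      have lim: "(\<lambda>n. f (u n)) \<longlonglongrightarrow> f l" for f :: "'a \<Rightarrow>\<^sub>L real"
        using u by (simp add: weakly_tendsto_def)
      have "(\<lambda>n. - \<zeta> (u n - zb) + pen k (u n)) \<longlonglongrightarrow> - \<zeta> (l - zb) + pen k l"
        unfolding pen_def blinfun.diff_right by (intro tendsto_intros lim)
      then have 1: "eventually (\<lambda>n. - \<zeta> (l - zb) + pen k l - e / 2 < - \<zeta> (u n - zb) + pen k (u n)) sequentially"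
        using e by (intro order_tendstoD(1)) auto
      have "eventually (\<lambda>n. gauge ((1 / \<rho>) *\<^sub>R (l - zb)) - e / (2 * (\<epsilon> * \<rho>)) < gauge ((1 / \<rho>) *\<^sub>R (u n - zb))) sequentially"
        by (rule gauge_weakly_lsc[OF weakly_tendsto_affine[OF u]]) (use e \<epsilon> \<rho> in simp)
      then have 2: "eventually (\<lambda>n. G l - e / 2 < G (u n)) sequentially"
      proof (rule eventually_mono)
        fix n
        assume "gauge ((1 / \<rho>) *\<^sub>R (l - zb)) - e / (2 * (\<epsilon> * \<rho>)) < gauge ((1 / \<rho>) *\<^sub>R (u n - zb))"
        from mult_strict_left_mono[OF this, of "\<epsilon> * \<rho>"] show "G l - e / 2 < G (u n)"
          using \<epsilon> \<rho> by (simp add: G_def right_diff_distrib)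
      qed
      from 1 2 show ?thesis
        by eventually_elim (simp add: J_def)
    qed
    moreover have "- (norm \<zeta> * r) - \<epsilon> * \<rho> \<le> J k z" if "z \<in> S" for z
      using \<zeta>_le[OF that] pen_nonneg[of k z] G_ge[of z] mult_nonneg_nonneg[OF less_imp_le[OF \<epsilon>] norm_ge_zero[of "z - zb"]]
      unfolding J_def by linarith
    ultimately obtain z where "z \<in> S" "\<And>u. u \<in> S \<Longrightarrow> J k z \<le> J k u"
      using weakly_lsc_attains_minimum[OF refl D(1,3) S(1,2) S_closed, where J = "J k"] S(3) by blast
    then show ?thesis
      by blast
  qed
  then obtain z where z: "\<And>k. z k \<in> S" "\<And>k u. u \<in> S \<Longrightarrow> J k (z k) \<le> J k u"
    by metis
  have z_le: "pen k (z k) + G (z k) \<le> \<zeta> (z k - zb)" for k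
  proof -
    have "J k (z k) \<le> J k zb"
      by (rule z(2)[OF S(3)])
    also have "\<dots> \<le> 0"
      using mult_nonneg_nonpos[OF _ gauge_zero_le, of "\<epsilon> * \<rho>"] \<epsilon> \<rho> zb by (simp add: J_def G_def pen_def \<phi>_def)
    finally show ?thesis
      by (simp add: J_def)
  qed
  \<comment> \<open>Along a weakly convergent subsequence the minimisers leave the sphere of radius \<open>r\<close>.\<close>
  have "\<exists>k. norm (z k - zb) < r"
  proof -
    have "norm (z n) \<le> norm zb + r" for n
      using z(1)[of n] S(2) norm_triangle_ineq2[of "z n" zb] by (auto simp: dist_norm norm_minus_commute)
    then obtain s l where s: "strict_mono s" "weakly_tendsto (z \<circ> s) l"
      using weakly_convergent_subsequence[OF refl D(1,3), of z] z(1) S(1) by blast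
    have lim: "(\<lambda>n. f (z (s n))) \<longlonglongrightarrow> f l" for f :: "'a \<Rightarrow>\<^sub>L real"
      using s(2) by (simp add: weakly_tendsto_def)
    have l: "l \<in> S"
      using S_closed s(2) z(1) unfolding weakly_seq_closed_def by (metis comp_apply)
    define M where "M = norm \<zeta> * r + \<epsilon> * \<rho>"
    have "\<phi> j l = 0" for j
    proof -
      have "(\<phi> j (z (s n)))\<^sup>2 \<le> M / real (s n)" if n: "j < s n" for n
      proof -
        have "real (s n) * (\<phi> j (z (s n)))\<^sup>2 \<le> pen (s n) (z (s n))"
          unfolding pen_def using n
          by (intro mult_left_mono member_le_sum[of j "{..<s n}" "\<lambda>j. (\<phi> j (z (s n)))\<^sup>2"]) auto
        also have "\<dots> \<le> M"
          using z_le[of "s n"] G_ge[of "z (s n)"] \<zeta>_le[OF z(1)[of "s n"]]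
            mult_nonneg_nonneg[OF less_imp_le[OF \<epsilon>] norm_ge_zero[of "z (s n) - zb"]]
          unfolding M_def by linarith
        finally show ?thesis
          using n by (simp add: pos_le_divide_eq mult.commute)
      qed
      moreover have "eventually (\<lambda>n. j < s n) sequentially"
        by (rule eventually_compose_filterlim[OF eventually_gt_at_top filterlim_subseq[OF s(1)]])
      ultimately have ev: "eventually (\<lambda>n. (\<phi> j (z (s n)))\<^sup>2 \<le> M / real (s n)) sequentially"
        by (rule eventually_mono[rotated]) blast
      have "(\<lambda>n. M / real (s n)) \<longlonglongrightarrow> 0"
        using tendsto_mult[OF tendsto_const[of M] LIMSEQ_subseq_LIMSEQ[OF lim_inverse_n' s(1)]]
        by (simp add: o_def)
      moreover have "(\<lambda>n. (\<phi> j (z (s n)))\<^sup>2) \<longlonglongrightarrow> (\<phi> j l)\<^sup>2"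
        by (intro tendsto_intros lim)
      ultimately have "(\<phi> j l)\<^sup>2 \<le> 0"
        using ev by (intro tendsto_le[OF sequentially_bot]) auto
      then show ?thesis
        by simp
    qed
    then have "A l = 0"
      using \<phi>_total l by (auto simp: S_def)
    have norm_l: "norm (l - zb) \<le> r"
      using l by (simp add: S_def dist_norm norm_minus_commute)
    have "\<zeta> (l - zb) \<le> \<epsilon> / 4 * norm (l - zb)"
      using \<delta>(2)[of l] \<open>A l = 0\<close> l norm_l r(2) by (simp add: S_def)
    also have "\<dots> \<le> \<epsilon> / 4 * r"
      using norm_l \<epsilon> by (intro mult_left_mono) auto
    also have "\<dots> < \<epsilon> / 2 * r"
      using \<epsilon> r by simp
    finally have "\<zeta> l - \<zeta> zb < \<epsilon> / 2 * r"
      by (simp add: blinfun.diff_right)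
    moreover have "(\<lambda>n. \<zeta> (z (s n)) - \<zeta> zb) \<longlonglongrightarrow> \<zeta> l - \<zeta> zb"
      by (intro tendsto_intros lim)
    ultimately have "eventually (\<lambda>n. \<zeta> (z (s n)) - \<zeta> zb < \<epsilon> / 2 * r) sequentially"
      by (intro order_tendstoD(2))
    then obtain n where "\<zeta> (z (s n)) - \<zeta> zb < \<epsilon> / 2 * r"
      using eventually_happens'[OF sequentially_bot] by blast
    then have "\<epsilon> * norm (z (s n) - zb) < \<epsilon> / 2 * r + \<epsilon> * \<rho>"
      using z_le[of "s n"] G_ge[of "z (s n)"] pen_nonneg[of "s n" "z (s n)"]
      by (simp add: blinfun.diff_right)
    also have "\<dots> < \<epsilon> * r"
      using \<epsilon> r by (simp add: \<rho>_def field_simps)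
    finally show ?thesis
      using \<epsilon> by auto
  qed
  then obtain k where k: "norm (z k - zb) < r"
    by blast
  have zk: "z k \<in> \<Omega>" "z k \<in> Y"
    using z(1)[of k] by (auto simp: S_def)
  define x where "x = (1 / \<rho>) *\<^sub>R (z k - zb)"
  obtain f where f: "norm f \<le> 1"
    "\<And>\<eta>. 0 < \<eta> \<Longrightarrow> \<exists>\<delta>>0. \<forall>h\<in>Y. norm h < \<delta> \<longrightarrow> gauge (x + h) \<le> gauge x + blinfun_apply f h + \<eta> * norm h"
    using gauge_superdifferentiable[of x] by blast
  define N where "N = \<zeta> - \<epsilon> *\<^sub>R f - (\<Sum>j<k. (2 * real k * \<phi> j (z k)) *\<^sub>R \<phi> j)"
  have N: "N w = \<zeta> w - \<epsilon> * f w - (\<Sum>j<k. 2 * real k * \<phi> j (z k) * \<phi> j w)" for w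
    by (simp add: N_def blinfun.diff_left blinfun.scaleR_left blinfun.sum_left)
  \<comment> \<open>The minimum condition at \<open>z k\<close>, with the superderivative of the bump and the derivative of the
    penalty; the remainder of the penalty is quadratic with constant \<open>B\<close>.\<close>
  have N_normal: "N \<in> frechet_normal_cone (\<Omega> \<inter> Y) (z k)"
    unfolding frechet_normal_iff
  proof (intro allI impI)
    fix \<eta> :: real
    assume \<eta>: "0 < \<eta>"
    obtain \<delta>1 where \<delta>1: "0 < \<delta>1" "\<And>h. h \<in> Y \<Longrightarrow> norm h < \<delta>1 \<Longrightarrow> gauge (x + h) \<le> gauge x + f h + \<eta> / (2 * \<epsilon>) * norm h"
      using f(2)[of "\<eta> / (2 * \<epsilon>)"] \<eta> \<epsilon> by auto
    define B where "B = real k * real k * (norm A)\<^sup>2"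
    have B: "0 \<le> B"
      by (simp add: B_def)
    \<comment> \<open>The three bounds keep \<open>u\<close> in the ball, make the expansion of the bump valid, and make the
      quadratic remainder at most \<open>\<eta> / 2 * norm h\<close>.\<close>
    define \<delta>2 where "\<delta>2 = Min {r - norm (z k - zb), \<rho> * \<delta>1, \<eta> / (2 * (B + 1))}"
    have "0 < \<delta>2"
      using k \<rho> \<delta>1(1) \<eta> B by (simp add: \<delta>2_def)
    moreover have "N (u - z k) \<le> \<eta> * norm (u - z k)" if u: "u \<in> \<Omega> \<inter> Y" "norm (u - z k) < \<delta>2" for u
    proof -
      define h where "h = u - z k"
      have h: "h \<in> Y" "norm h < r - norm (z k - zb)" "norm h < \<rho> * \<delta>1" "norm h < \<eta> / (2 * (B + 1))"
        using u zk subspace_diff[OF Y(1)] by (auto simp: h_def \<delta>2_def)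
      have "norm (u - zb) \<le> r"
        using norm_triangle_ineq[of "u - z k" "z k - zb"] h(2) by (simp add: h_def)
      then have "u \<in> S"
        using u by (simp add: S_def dist_norm norm_minus_commute)
      then have "J k (z k) \<le> J k u"
        by (rule z(2))
      then have 1: "\<zeta> h \<le> (pen k u - pen k (z k)) + (G u - G (z k))"
        by (simp add: J_def h_def blinfun.diff_right)
      have 2: "G u - G (z k) \<le> \<epsilon> * f h + \<eta> / 2 * norm h"
      proof -
        have "gauge (x + (1 / \<rho>) *\<^sub>R h) \<le> gauge x + f ((1 / \<rho>) *\<^sub>R h) + \<eta> / (2 * \<epsilon>) * norm ((1 / \<rho>) *\<^sub>R h)"
        proof (rule \<delta>1(2))
          show "(1 / \<rho>) *\<^sub>R h \<in> Y"
            by (rule subspace_scale[OF Y(1) h(1)])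
          show "norm ((1 / \<rho>) *\<^sub>R h) < \<delta>1"
            using h(3) \<rho> by (simp add: divide_less_eq mult.commute)
        qed
        from mult_left_mono[OF this, of "\<epsilon> * \<rho>"]
        have "\<epsilon> * \<rho> * gauge (x + (1 / \<rho>) *\<^sub>R h) \<le> \<epsilon> * \<rho> * gauge x + \<epsilon> * f h + \<eta> / 2 * norm h"
          using \<epsilon> \<rho> by (simp add: blinfun.scaleR_right distrib_left)
        moreover have "x + (1 / \<rho>) *\<^sub>R h = (1 / \<rho>) *\<^sub>R (u - zb)"
          by (simp add: x_def h_def flip: scaleR_add_right)
        ultimately show ?thesis
          by (simp add: G_def x_def)
      qed
      have 3: "pen k u - pen k (z k) \<le> (\<Sum>j<k. 2 * real k * \<phi> j (z k) * \<phi> j h) + \<eta> / 2 * norm h"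
      proof -
        have "pen k u - pen k (z k) = real k * (\<Sum>j<k. (\<phi> j u)\<^sup>2 - (\<phi> j (z k))\<^sup>2)"
          by (simp add: pen_def sum_subtractf right_diff_distrib)
        also have "(\<Sum>j<k. (\<phi> j u)\<^sup>2 - (\<phi> j (z k))\<^sup>2) = (\<Sum>j<k. 2 * \<phi> j (z k) * \<phi> j h) + (\<Sum>j<k. (\<phi> j h)\<^sup>2)"
          unfolding sum.distrib[symmetric]
          by (rule sum.cong) (simp_all add: h_def blinfun.diff_right power2_eq_square algebra_simps)
        also have "real k * \<dots> = (\<Sum>j<k. 2 * real k * \<phi> j (z k) * \<phi> j h) + real k * (\<Sum>j<k. (\<phi> j h)\<^sup>2)"
          by (simp add: distrib_left sum_distrib_left mult_ac)
        also have "real k * (\<Sum>j<k. (\<phi> j h)\<^sup>2) \<le> real k * (\<Sum>j<k. (norm A * norm h)\<^sup>2)"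
        proof (intro mult_left_mono sum_mono)
          fix j
          have "\<bar>\<phi> j h\<bar> \<le> norm A * norm h"
            using \<phi>_le[of j h] norm_blinfun[of A h] by simp
          then show "(\<phi> j h)\<^sup>2 \<le> (norm A * norm h)\<^sup>2"
            by (simp add: abs_le_square_iff[symmetric])
        qed simp
        also have "\<dots> = (B * norm h) * norm h"
          by (simp add: B_def power2_eq_square)
        also have "\<dots> \<le> \<eta> / 2 * norm h"
        proof (rule mult_right_mono)
          have "B * norm h \<le> (B + 1) * norm h"
            by (simp add: mult_right_mono)
          also have "\<dots> \<le> \<eta> / 2"
            using h(4) B by (simp add: pos_less_divide_eq algebra_simps)
          finally show "B * norm h \<le> \<eta> / 2" .
        qed simp
        finally show ?thesis
          by simp
      qed
      have "N h \<le> \<eta> * norm h"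
        using 1 2 3 unfolding N by linarith
      then show ?thesis
        by (simp add: h_def)
    qed
    ultimately show "\<exists>\<delta>>0. \<forall>u\<in>\<Omega> \<inter> Y. norm (u - z k) < \<delta> \<longrightarrow> N (u - z k) \<le> \<eta> * norm (u - z k)"
      by blast
  qed
  define c where "c = nat \<lceil>\<Sum>j<k. \<bar>2 * real k * \<phi> j (z k)\<bar>\<rceil>"
  have N_le: "N w \<le> \<sigma> c w" for w
  proof -
    have "\<bar>f w\<bar> \<le> norm w"
      using norm_blinfun[of f w] mult_right_mono[OF f(1) norm_ge_zero[of w]] by simp
    then have "- (\<epsilon> * f w) \<le> \<epsilon> * norm w"
      using mult_left_mono[of "- f w" "norm w" \<epsilon>] \<epsilon> by (simp add: abs_le_iff)
    moreover have "- (\<Sum>j<k. 2 * real k * \<phi> j (z k) * \<phi> j w) \<le> real c * norm (A w)"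
    proof -
      have "- (\<Sum>j<k. 2 * real k * \<phi> j (z k) * \<phi> j w) \<le> \<bar>\<Sum>j<k. 2 * real k * \<phi> j (z k) * \<phi> j w\<bar>"
        by simp
      also have "\<dots> \<le> (\<Sum>j<k. \<bar>2 * real k * \<phi> j (z k) * \<phi> j w\<bar>)"
        by (rule sum_abs)
      also have "\<dots> \<le> (\<Sum>j<k. \<bar>2 * real k * \<phi> j (z k)\<bar> * norm (A w))"
        unfolding abs_mult[of _ "\<phi> _ w"] by (intro sum_mono mult_left_mono \<phi>_le) simp
      also have "\<dots> = (\<Sum>j<k. \<bar>2 * real k * \<phi> j (z k)\<bar>) * norm (A w)"
        by (simp add: sum_distrib_right)
      also have "\<dots> \<le> real c * norm (A w)"
        unfolding c_def by (intro mult_right_mono real_nat_ceiling_ge) simp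
      finally show ?thesis .
    qed
    ultimately show ?thesis
      unfolding N \<sigma>_def by linarith
  qed
  obtain n where n: "n \<in> frechet_normal_cone \<Omega> (z k)" "\<And>w. n w \<le> \<sigma> c w"
    using lift[of "z k" N c] zk N_normal N_le unfolding Y_def by blast
  show thesis
  proof
    show "z k \<in> \<Omega> \<inter> ball zb \<epsilon>"
      using zk k r by (simp add: dist_norm norm_minus_commute)
    show "n \<in> frechet_normal_cone \<Omega> (z k)"
      by (rule n(1))
    show "\<bar>n w - \<zeta> w\<bar> \<le> \<epsilon> * norm w" if "A w = 0" for w
      using n(2)[of w] n(2)[of "- w"] that by (simp add: \<sigma>_def blinfun.minus_right)
  qed
qed

section \<open>The intersection rule\<close>

lemma reflexive_space_prod:
  assumes "reflexive_space TYPE('a::real_normed_vector)" "reflexive_space TYPE('b::real_normed_vector)"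
  shows "reflexive_space TYPE('a \<times> 'b)"
  unfolding reflexive_space_def
proof (rule surjI)
  fix L :: "(('a \<times> 'b) \<Rightarrow>\<^sub>L real) \<Rightarrow>\<^sub>L real"
  have comp: "linear (\<lambda>f. L (f o\<^sub>L P))" "\<And>f. L (f o\<^sub>L P) \<le> (norm L * norm P) * norm f"
    for P :: "('a \<times> 'b) \<Rightarrow>\<^sub>L 'c::real_normed_vector"
  proof -
    have "(f + f') o\<^sub>L P = (f o\<^sub>L P) + (f' o\<^sub>L P)" "(t *\<^sub>R f) o\<^sub>L P = t *\<^sub>R (f o\<^sub>L P)"
      for f f' :: "'c \<Rightarrow>\<^sub>L real" and t
      by (rule blinfun_eqI, simp add: blinfun.add_left blinfun.scaleR_left)+
    then show "linear (\<lambda>f. L (f o\<^sub>L P))"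
      by (intro linearI) (simp_all add: blinfun.add_right blinfun.scaleR_right)
    fix f :: "'c \<Rightarrow>\<^sub>L real"
    have "L (f o\<^sub>L P) \<le> norm L * norm (f o\<^sub>L P)"
      using norm_blinfun[of L "f o\<^sub>L P"] by simp
    also have "\<dots> \<le> norm L * (norm f * norm P)"
      by (intro mult_left_mono norm_blinfun_compose) simp
    finally show "L (f o\<^sub>L P) \<le> (norm L * norm P) * norm f"
      by (simp add: mult_ac)
  qed
  obtain x where x: "\<And>f. L (f o\<^sub>L fst_blinfun) = blinfun_apply f x"
    using reflexive_representation[OF assms(1) comp] by metis
  obtain y where y: "\<And>f. L (f o\<^sub>L snd_blinfun) = blinfun_apply f y"
    using reflexive_representation[OF assms(2) comp] by metis
  have "L F = F (x, y)" for F :: "('a \<times> 'b) \<Rightarrow>\<^sub>L real"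
  proof -
    define F1 where "F1 = F o\<^sub>L Blinfun (\<lambda>x. (x, 0))"
    define F2 where "F2 = F o\<^sub>L Blinfun (\<lambda>y. (0, y))"
    have F1: "F1 x = F (x, 0)" and F2: "F2 y = F (0, y)" for x y
      by (simp_all add: F1_def F2_def bounded_linear_Blinfun_apply bounded_linear_Pair
          bounded_linear_ident bounded_linear_zero)
    have split: "F (x, 0) + F (0, y) = F (x, y)" for x y
      by (simp flip: blinfun.add_right)
    then have "F = (F1 o\<^sub>L fst_blinfun) + (F2 o\<^sub>L snd_blinfun)"
      by (intro blinfun_eqI) (auto simp: blinfun.add_left F1 F2)
    then have "L F = F1 x + F2 y"
      by (simp add: blinfun.add_right x y)
    then show ?thesis
      by (simp add: F1 F2 split)
  qed
  then have "\<exists>z. bidual_embedding z = L"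
    by (intro exI[of _ "(x, y)"] blinfun_eqI) simp
  then show "bidual_embedding (SOME z. bidual_embedding z = L) = L"
    by (rule someI_ex)
qed

lemma weakly_seq_closed_Times:
  assumes "weakly_seq_closed S" "weakly_seq_closed T"
  shows "weakly_seq_closed (S \<times> T)"
  unfolding weakly_seq_closed_def
proof (intro allI impI)
  fix u l
  assume u: "(\<forall>n. u n \<in> S \<times> T) \<and> weakly_tendsto u l"
  have "weakly_tendsto (\<lambda>n. P (u n)) (P l)" for P :: "('a \<times> 'b) \<Rightarrow>\<^sub>L 'c::real_normed_vector"
    unfolding weakly_tendsto_def
  proof
    fix f :: "'c \<Rightarrow>\<^sub>L real"
    show "(\<lambda>n. f (P (u n))) \<longlonglongrightarrow> f (P l)"
      using u by (auto simp: weakly_tendsto_def dest!: spec[of _ "f o\<^sub>L P"])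
  qed
  from this[of fst_blinfun] this[of snd_blinfun]
  have "weakly_tendsto (\<lambda>n. fst (u n)) (fst l)" "weakly_tendsto (\<lambda>n. snd (u n)) (snd l)"
    by simp_all
  moreover have "\<forall>n. fst (u n) \<in> S" "\<forall>n. snd (u n) \<in> T"
    using u by (auto simp: mem_Times_iff)
  ultimately have "fst l \<in> S \<and> snd l \<in> T"
    using assms[unfolded weakly_seq_closed_def, rule_format] by auto
  then show "l \<in> S \<times> T"
    by (simp add: mem_Times_iff)
qed

text \<open>
  Here \<open>i\<close> is an affine map with linear part \<open>P\<close> that carries \<open>S\<close> into \<open>T\<close>. It moves normals between the factors
  and the product.
\<close>

lemma frechet_normal_cone_vimage:
  fixes n :: "'b::real_normed_vector \<Rightarrow>\<^sub>L real" and i :: "'a::real_normed_vector \<Rightarrow> 'b" and P :: "'a \<Rightarrow>\<^sub>L 'b"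
  assumes n: "n \<in> frechet_normal_cone T (i x)"
    and i: "\<And>u. u \<in> S \<Longrightarrow> i u \<in> T" "\<And>u. i u - i x = P (u - x)"
  shows "n o\<^sub>L P \<in> frechet_normal_cone S x"
  unfolding frechet_normal_iff
proof (intro allI impI)
  fix \<eta> :: real
  assume \<eta>: "0 < \<eta>"
  define K where "K = norm P + 1"
  have K: "0 < K"
    by (simp add: K_def add_nonneg_pos)
  have le: "norm (i u - i x) \<le> K * norm (u - x)" for u
    using norm_blinfun[of P "u - x"] by (simp add: i K_def distrib_right add_increasing2)
  obtain \<delta> where \<delta>: "0 < \<delta>"
    "\<And>v. v \<in> T \<Longrightarrow> norm (v - i x) < \<delta> \<Longrightarrow> n (v - i x) \<le> \<eta> / K * norm (v - i x)"
    using n \<eta> K unfolding frechet_normal_iff by (meson divide_pos_pos)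
  have "(n o\<^sub>L P) (u - x) \<le> \<eta> * norm (u - x)" if u: "u \<in> S" "norm (u - x) < \<delta> / K" for u
  proof -
    have "norm (i u - i x) < \<delta>"
      using le[of u] u(2) K by (simp add: pos_less_divide_eq mult.commute)
    then have "n (i u - i x) \<le> \<eta> / K * norm (i u - i x)"
      using \<delta>(2) i(1) u(1) by blast
    also have "\<dots> \<le> \<eta> / K * (K * norm (u - x))"
      using \<eta> K by (intro mult_left_mono le) auto
    finally show ?thesis
      using K by (simp add: i(2))
  qed
  then show "\<exists>\<delta>>0. \<forall>u\<in>S. norm (u - x) < \<delta> \<longrightarrow> (n o\<^sub>L P) (u - x) \<le> \<eta> * norm (u - x)"
    using \<delta>(1) K by (intro exI[of _ "\<delta> / K"]) auto
qed

theorem corollary7p3: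
  fixes \<Omega>1 \<Omega>2 :: "'a::banach set"
    and xbar :: 'a
    and xstar :: "'a \<Rightarrow>\<^sub>L real"
    and \<epsilon> :: real
  assumes "reflexive_space TYPE('a)"
    and "weakly_seq_closed \<Omega>1"
    and "weakly_seq_closed \<Omega>2"
    and "xbar \<in> \<Omega>1 \<inter> \<Omega>2"
    and "xstar \<in> frechet_normal_cone (\<Omega>1 \<inter> \<Omega>2) xbar"
    and "\<epsilon> > 0"
  shows "\<exists>x1 \<in> \<Omega>1 \<inter> ball xbar \<epsilon>. \<exists>x2 \<in> \<Omega>2 \<inter> ball xbar \<epsilon>.
    infdist xstar (frechet_normal_cone \<Omega>1 x1 + frechet_normal_cone \<Omega>2 x2) < \<epsilon>"
proof -
  define A :: "('a \<times> 'a) \<Rightarrow>\<^sub>L 'a" where "A = fst_blinfun - snd_blinfun"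
  define \<zeta> where "\<zeta> = xstar o\<^sub>L (fst_blinfun :: ('a \<times> 'a) \<Rightarrow>\<^sub>L 'a)"
  define I1 :: "'a \<Rightarrow>\<^sub>L ('a \<times> 'a)" where "I1 = Blinfun (\<lambda>x. (x, 0))"
  define I2 :: "'a \<Rightarrow>\<^sub>L ('a \<times> 'a)" where "I2 = Blinfun (\<lambda>x. (0, x))"
  have A: "A z = fst z - snd z" and \<zeta>: "\<zeta> z = xstar (fst z)" for z
    by (simp_all add: A_def \<zeta>_def blinfun.diff_left)
  have I1: "I1 x = (x, 0)" and I2: "I2 x = (0, x)" for x
    by (simp_all add: I1_def I2_def bounded_linear_Blinfun_apply bounded_linear_Pair
        bounded_linear_ident bounded_linear_zero)
  have "\<zeta> \<in> frechet_normal_cone (\<Omega>1 \<times> \<Omega>2 \<inter> {z. A z = 0}) (xbar, xbar)"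
    unfolding \<zeta>_def
  proof (rule frechet_normal_cone_vimage)
    show "xstar \<in> frechet_normal_cone (\<Omega>1 \<inter> \<Omega>2) (fst (xbar, xbar))"
      using assms(5) by simp
  qed (auto simp: A)
  then obtain z n where z: "z \<in> \<Omega>1 \<times> \<Omega>2 \<inter> ball (xbar, xbar) (\<epsilon> / 2)"
    and n: "n \<in> frechet_normal_cone (\<Omega>1 \<times> \<Omega>2) z"
    and close: "\<And>w. A w = 0 \<Longrightarrow> \<bar>n w - \<zeta> w\<bar> \<le> \<epsilon> / 2 * norm w"
    using fuzzy_multiplier_rule[OF reflexive_space_prod[OF assms(1,1)] weakly_seq_closed_Times[OF assms(2,3)],
        of "(xbar, xbar)" A \<zeta> "\<epsilon> / 2"] assms(4,6) by (auto simp: A)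
  obtain x1 x2 where x: "z = (x1, x2)"
    by (cases z)
  have dist: "dist (xbar, xbar) (x1, x2) < \<epsilon> / 2"
    using z x by simp
  have x1: "x1 \<in> \<Omega>1 \<inter> ball xbar \<epsilon>"
    using z x dist dist_fst_le[of "(xbar, xbar)" "(x1, x2)"] \<open>\<epsilon> > 0\<close> by simp
  have x2: "x2 \<in> \<Omega>2 \<inter> ball xbar \<epsilon>"
    using z x dist dist_snd_le[of "(xbar, xbar)" "(x1, x2)"] \<open>\<epsilon> > 0\<close> by simp
  have "n o\<^sub>L I1 \<in> frechet_normal_cone \<Omega>1 x1"
    by (rule frechet_normal_cone_vimage[where i = "\<lambda>u. (u, x2)"]) (use n x x2 in \<open>auto simp: I1\<close>)
  moreover have "n o\<^sub>L I2 \<in> frechet_normal_cone \<Omega>2 x2"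
    by (rule frechet_normal_cone_vimage[where i = "\<lambda>u. (x1, u)"]) (use n x x1 in \<open>auto simp: I2\<close>)
  ultimately have mem: "(n o\<^sub>L I1) + (n o\<^sub>L I2) \<in> frechet_normal_cone \<Omega>1 x1 + frechet_normal_cone \<Omega>2 x2"
    by (rule set_plus_intro)
  \<comment> \<open>The norm of a pair is Euclidean, so the bound \<open>\<epsilon> / 2\<close> on the diagonal grows by \<open>sqrt 2 < 2\<close>.\<close>
  have "norm (xstar - ((n o\<^sub>L I1) + (n o\<^sub>L I2))) \<le> \<epsilon> / 2 * sqrt 2"
  proof (rule norm_blinfun_bound)
    fix w
    have "(xstar - ((n o\<^sub>L I1) + (n o\<^sub>L I2))) w = \<zeta> (w, w) - n ((w, 0) + (0, w))"
      by (simp add: blinfun.diff_left blinfun.add_left blinfun.add_right \<zeta> I1 I2 del: add_Pair)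
    then have "norm ((xstar - ((n o\<^sub>L I1) + (n o\<^sub>L I2))) w) = \<bar>n (w, w) - \<zeta> (w, w)\<bar>"
      by (simp add: abs_minus_commute)
    also have "\<dots> \<le> \<epsilon> / 2 * norm (w, w)"
      by (rule close) (simp add: A)
    also have "norm (w, w) = sqrt 2 * norm w"
      by (simp add: norm_Pair real_sqrt_mult flip: mult_2)
    finally show "norm ((xstar - ((n o\<^sub>L I1) + (n o\<^sub>L I2))) w) \<le> \<epsilon> / 2 * sqrt 2 * norm w"
      by simp
  qed (use \<open>\<epsilon> > 0\<close> in simp)
  also have "\<dots> < \<epsilon>"
    using \<open>\<epsilon> > 0\<close> sqrt2_less_2 by simp
  finally have "dist xstar ((n o\<^sub>L I1) + (n o\<^sub>L I2)) < \<epsilon>"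
    by (simp add: dist_norm)
  with infdist_le[OF mem, of xstar]
  have "infdist xstar (frechet_normal_cone \<Omega>1 x1 + frechet_normal_cone \<Omega>2 x2) < \<epsilon>"
    by simp
  then show ?thesis
    using x1 x2 by blast
qed

end
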